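(* Let $E$ be a Dedekind complete vector lattice, let $\mathcal{S}$ be a non-empty subset of $\mathcal{L}_{\mathrm{ob}}(E)$, and let $B_{\mathcal{S}}$ be the band in $\mathcal{L}_{\mathrm{ob}}(E)$ that is generated by $\mathcal{S}$. Then the commutant $$\mathcal{S}'_{\mathrm{Orth}}:=\{T\in\mathrm{Orth}(E): TS=ST\text{ for all }S\in\mathcal{S}\}$$ of $\mathcal{S}$ in $\mathrm{Orth}(E)$ and the commutant $$(B_{\mathcal{S}})'_{\mathrm{Orth}}:=\{T\in\mathrm{Orth}(E): TS=ST\text{ for all }S\in B_{\mathcal{S}}\}$$ of $B_{\mathcal{S}}$ in $\mathrm{Orth}(E)$ are equal. This common commutant in $\mathrm{Orth}(E)$ is a vector lattice subalgebra of $\mathrm{Orth}(E)$ that contains the identity operator $I$ as a weak order unit. Suppose that $\mathcal{S}\subseteq\mathcal{L}_{\mathrm{oc}}(E)$. Then: (1) $\mathcal{S}'_{\mathrm{Orth}}$ is an order closed vector sublattice of every regular vector sublattice of $\mathcal{L}_{\mathrm{ob}}(E)$ containing $\mathcal{S}'_{\mathrm{Orth}}$; (2) $\mathcal{S}'_{\mathrm{Orth}}$ is a regular vector sublattice of every Dedekind complete regular vector sublattice of $\mathcal{L}_{\mathrm{ob}}(E)$ containing $\mathcal{S}'_{\mathrm{Orth}}$; (3) $\mathcal{S}'_{\mathrm{Orth}}$ is a Dedekind complete vector lattice.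
   Context: All vector lattices are real and Archimedean. $\mathcal{L}_{\mathrm{ob}}(E)$ is the space of order bounded linear operators on $E$, a Dedekind complete vector lattice in the operator order when $E$ is Dedekind complete. $\mathcal{L}_{\mathrm{oc}}(E)$ is the set of order continuous linear operators on $E$ (those $T$ with $Tx_\alpha\xrightarrow{\mathrm{o}}0$ whenever $x_\alpha\xrightarrow{\mathrm{o}}0$). $\mathrm{Orth}(E)$ is the vector lattice algebra of orthomorphisms on $E$, i.e. of order bounded linear operators $T:E\to E$ with $T(B)\subseteq B$ for every band $B$ of $E$. A vector lattice subalgebra is an associative subalgebra that is also a vector sublattice. A weak order unit of a vector lattice is an element that generates the whole vector lattice as a band. In a vector lattice $G$, a net $(x_\alpha)_{\alpha\in A}$ is order convergent to $x$ ($x_\alpha\xrightarrow{\mathrm{o}}x$) if there is a net $(y_\beta)_{\beta\in B}$ in $G$ with $y_\beta\downarrow 0$ such that for every $\beta_0\in B$ there is $\alpha_0\in A$ with $|x-x_\alpha|\le y_{\beta_0}$ for all $\alpha\ge\alpha_0$. A subset $H$ of $G$ is order closed in $G$ if every limit in $G$ of a net in $H$ that is order convergent in $G$ lies in $H$. A vector sublattice $H$ of $G$ is regular if the inclusion map $H\to G$ is order continuous. *)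

theory Defs
  imports Complex_Main "HOL-Library.Lattice_Algebras" "HOL-Library.Lub_Glb"
begin

section \<open>Vector lattices\<close>

class vector_lattice = ordered_real_vector + lattice_ab_group_add_abs

text \<open>
  Dedekind complete: every non-empty subset that is bounded above has a supremum. The operations
  \<open>Sup\<close> and \<open>Inf\<close> of the class are unconstrained on all other sets, so every Dedekind complete
  vector lattice can be made an instance. Such a vector lattice is automatically Archimedean.
\<close>

class dedekind_complete_vector_lattice = vector_lattice + conditionally_complete_lattice

text \<open>
  In the following, a vector lattice \<open>G\<close> is given as a vector sublattice of a type of class
  \<^class>\<open>vector_lattice\<close> (with \<^term>\<open>UNIV\<close> for the type itself). Its finite lattice operations and
  absolute value are those of the type, but suprema and infima of infinite sets, and hence also
  order convergence, have to be taken in \<open>G\<close>.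
\<close>

definition vector_sublattice :: "'g::vector_lattice set \<Rightarrow> bool" where
  "vector_sublattice H \<longleftrightarrow>
     subspace H \<and> (\<forall>x\<in>H. \<forall>y\<in>H. sup x y \<in> H \<and> inf x y \<in> H)"

definition dedekind_complete :: "'g::vector_lattice set \<Rightarrow> bool" where
  "dedekind_complete G \<longleftrightarrow>
     (\<forall>X. X \<subseteq> G \<and> X \<noteq> {} \<and> (\<exists>u. isUb G X u) \<longrightarrow> (\<exists>s. isLub G X s))"


section \<open>Order convergence\<close>

definition directed :: "'i set \<Rightarrow> ('i \<Rightarrow> 'i \<Rightarrow> bool) \<Rightarrow> bool" where
  "directed A r \<longleftrightarrow> A \<noteq> {} \<and> reflp_on A r \<and> transp_on A r \<and>
     (\<forall>a\<in>A. \<forall>b\<in>A. \<exists>c\<in>A. r a c \<and> r b c)"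

text \<open>A net in \<open>G\<close>, indexed by \<open>(B, s)\<close>, that decreases to \<open>0\<close> in \<open>G\<close>.\<close>

definition decreases_to_zero ::
  "'g::vector_lattice set \<Rightarrow> 'i set \<Rightarrow> ('i \<Rightarrow> 'i \<Rightarrow> bool) \<Rightarrow> ('i \<Rightarrow> 'g) \<Rightarrow> bool" where
  "decreases_to_zero G B s y \<longleftrightarrow> directed B s \<and> y ` B \<subseteq> G \<and>
     (\<forall>b\<in>B. \<forall>c\<in>B. s b c \<longrightarrow> y c \<le> y b) \<and> isGlb G (y ` B) 0"

text \<open>
  \<open>order_converges G A r x l\<close>: the net \<open>(x a)\<close>, indexed by \<open>(A, r)\<close>, is order convergent to \<open>l\<close>
  in \<open>G\<close>. The index set of the dominating net is taken in the type of \<open>G\<close>; this is no restriction,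
  see \<open>order_convergesI\<close> below.
\<close>

definition order_converges ::
  "'g::vector_lattice set \<Rightarrow> 'i set \<Rightarrow> ('i \<Rightarrow> 'i \<Rightarrow> bool) \<Rightarrow> ('i \<Rightarrow> 'g) \<Rightarrow> 'g \<Rightarrow> bool" where
  "order_converges G A r x l \<longleftrightarrow> directed A r \<and> x ` A \<subseteq> G \<and> l \<in> G \<and>
     (\<exists>(B::'g set) s y. decreases_to_zero G B s y \<and>
        (\<forall>b\<in>B. \<exists>a\<in>A. \<forall>a'\<in>A. r a a' \<longrightarrow> \<bar>l - x a'\<bar> \<le> y b))"

text \<open>
  The next two definitions quantify over nets whose index sets lie in the type of the vector lattice
  containing the net. For order closedness and for regularity this is no restriction, see
  \<open>order_closedD\<close> and \<open>regularD\<close> below.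
\<close>

definition order_closed :: "'g::vector_lattice set \<Rightarrow> 'g set \<Rightarrow> bool" where
  "order_closed G H \<longleftrightarrow> H \<subseteq> G \<and>
     (\<forall>(A::'g set) r x l. order_converges G A r x l \<and> x ` A \<subseteq> H \<longrightarrow> l \<in> H)"

definition order_continuous ::
  "'g::vector_lattice set \<Rightarrow> 'h::vector_lattice set \<Rightarrow> ('g \<Rightarrow> 'h) \<Rightarrow> bool" where
  "order_continuous G H f \<longleftrightarrow>
     (\<forall>(A::'g set) r x. order_converges G A r x 0 \<longrightarrow> order_converges H A r (f \<circ> x) 0)"

definition regular_sublattice :: "'g::vector_lattice set \<Rightarrow> 'g set \<Rightarrow> bool" where
  "regular_sublattice G H \<longleftrightarrow> vector_sublattice H \<and> H \<subseteq> G \<and> order_continuous H G (\<lambda>x. x)"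

lemma order_convergesI:
  fixes y :: "'j \<Rightarrow> 'g::vector_lattice"
  assumes "directed A r" and "x ` A \<subseteq> G" and "l \<in> G" and y: "decreases_to_zero G B s y"
    and dom: "\<And>b. b \<in> B \<Longrightarrow> \<exists>a\<in>A. \<forall>a'\<in>A. r a a' \<longrightarrow> \<bar>l - x a'\<bar> \<le> y b"
  shows "order_converges G A r x l"
proof -
  have "decreases_to_zero G (y ` B) (\<lambda>u v. v \<le> u) (\<lambda>u. u)"
    unfolding decreases_to_zero_def directed_def
  proof (intro conjI ballI)
    fix u v assume "u \<in> y ` B" "v \<in> y ` B"
    then obtain b c where "b \<in> B" "c \<in> B" "u = y b" "v = y c" by blast
    moreover from this obtain d where "d \<in> B" "s b d" "s c d"
      using y unfolding decreases_to_zero_def directed_def by blast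
    ultimately show "\<exists>w\<in>y ` B. w \<le> u \<and> w \<le> v"
      using y unfolding decreases_to_zero_def by blast
  qed (use y in \<open>auto simp: decreases_to_zero_def directed_def reflp_on_def transp_on_def\<close>)
  moreover have "\<forall>u\<in>y ` B. \<exists>a\<in>A. \<forall>a'\<in>A. r a a' \<longrightarrow> \<bar>l - x a'\<bar> \<le> u"
    using dom by auto
  ultimately show ?thesis
    using assms(1-3) unfolding order_converges_def by blast
qed

lemma order_closedD:
  fixes x :: "'i \<Rightarrow> 'g::vector_lattice"
  assumes "order_closed G H" and conv: "order_converges G A r x l" and "x ` A \<subseteq> H"
  shows "l \<in> H"
proof -
  obtain B :: "'g set" and s y where y: "decreases_to_zero G B s y"
    and "\<forall>b\<in>B. \<exists>a\<in>A. \<forall>a'\<in>A. r a a' \<longrightarrow> \<bar>l - x a'\<bar> \<le> y b"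
    using conv unfolding order_converges_def by blast
  then obtain f where f: "\<And>b. b \<in> B \<Longrightarrow> f b \<in> A"
    "\<And>b a. b \<in> B \<Longrightarrow> a \<in> A \<Longrightarrow> r (f b) a \<Longrightarrow> \<bar>l - x a\<bar> \<le> y b"
    by metis
  have A: "reflp_on A r" "x ` A \<subseteq> G" "l \<in> G" and B: "directed B s"
    using conv y unfolding order_converges_def directed_def decreases_to_zero_def by auto
  have "\<bar>l - x (f c)\<bar> \<le> y b" if "b \<in> B" "c \<in> B" "s b c" for b c
  proof -
    have "\<bar>l - x (f c)\<bar> \<le> y c"
      using f that A by (metis reflp_onD)
    also have "\<dots> \<le> y b"
      using y that unfolding decreases_to_zero_def by blast
    finally show ?thesis .
  qed
  then have "order_converges G B s (x \<circ> f) l"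
    using A B f(1) by (intro order_convergesI[OF _ _ _ y]) auto
  moreover have "(x \<circ> f) ` B \<subseteq> H"
    using f(1) assms(3) by auto
  ultimately show ?thesis
    using assms(1) unfolding order_closed_def by blast
qed

lemma regularD:
  fixes x :: "'i \<Rightarrow> 'g::vector_lattice"
  assumes reg: "regular_sublattice G H" and conv: "order_converges H A r x 0"
  shows "order_converges G A r x 0"
proof -
  obtain B :: "'g set" and s y where y: "decreases_to_zero H B s y"
    and dom: "\<forall>b\<in>B. \<exists>a\<in>A. \<forall>a'\<in>A. r a a' \<longrightarrow> \<bar>0 - x a'\<bar> \<le> y b"
    using conv unfolding order_converges_def by blast
  have y0: "0 \<le> y b" if "b \<in> B" for b
    using y that
    by (auto simp: decreases_to_zero_def isGlb_def greatestP_def isLb_def setge_def)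
  have "0 \<in> H" "directed B s" "y ` B \<subseteq> H"
    using conv y by (auto simp: order_converges_def decreases_to_zero_def)
  moreover have "\<bar>0 - y c\<bar> \<le> y b" if "b \<in> B" "c \<in> B" "s b c" for b c
    using y y0 that unfolding decreases_to_zero_def by auto
  ultimately have "order_converges H B s y 0"
    by (intro order_convergesI[OF _ _ _ y]) auto
  then have "order_converges G B s y 0"
    using reg unfolding regular_sublattice_def order_continuous_def comp_def by blast
  then obtain B' :: "'g set" and s' y' where y': "decreases_to_zero G B' s' y'"
    and dom': "\<forall>b'\<in>B'. \<exists>b\<in>B. \<forall>c\<in>B. s b c \<longrightarrow> \<bar>0 - y c\<bar> \<le> y' b'"
    unfolding order_converges_def by blast
  have "\<exists>a\<in>A. \<forall>a'\<in>A. r a a' \<longrightarrow> \<bar>0 - x a'\<bar> \<le> y' b'" if "b' \<in> B'" for b'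
  proof -
    obtain b where b: "b \<in> B" "\<forall>c\<in>B. s b c \<longrightarrow> \<bar>0 - y c\<bar> \<le> y' b'"
      using dom' \<open>b' \<in> B'\<close> by blast
    have "\<bar>0 - y b\<bar> \<le> y' b'"
      using b \<open>directed B s\<close> unfolding directed_def by (meson reflp_onD)
    then have "y b \<le> y' b'"
      using y0[OF b(1)] by simp
    then show ?thesis
      using dom b(1) by (meson order_trans)
  qed
  moreover have "directed A r" "x ` A \<subseteq> G" "0 \<in> G"
    using conv reg unfolding order_converges_def regular_sublattice_def by auto
  ultimately show ?thesis
    by (intro order_convergesI[OF _ _ _ y'])
qed


section \<open>Bands\<close>

definition ideal :: "'g::vector_lattice set \<Rightarrow> 'g set \<Rightarrow> bool" where
  "ideal G I \<longleftrightarrow> I \<subseteq> G \<and> subspace I \<and> (\<forall>x\<in>G. \<forall>y\<in>I. \<bar>x\<bar> \<le> \<bar>y\<bar> \<longrightarrow> x \<in> I)"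

definition band :: "'g::vector_lattice set \<Rightarrow> 'g set \<Rightarrow> bool" where
  "band G B \<longleftrightarrow> ideal G B \<and> order_closed G B"

definition generated_band :: "'g::vector_lattice set \<Rightarrow> 'g set \<Rightarrow> 'g set" where
  "generated_band G X = \<Inter> {B. band G B \<and> X \<subseteq> B}"

definition weak_order_unit :: "'g::vector_lattice set \<Rightarrow> 'g \<Rightarrow> bool" where
  "weak_order_unit G e \<longleftrightarrow> e \<in> G \<and> generated_band G {e} = G"


section \<open>Order bounded operators\<close>

definition order_bounded :: "('a::vector_lattice \<Rightarrow> 'a) \<Rightarrow> bool" where
  "order_bounded T \<longleftrightarrow> (\<forall>a b. \<exists>c d. T ` {a..b} \<subseteq> {c..d})"

lemma order_bounded_zero: "order_bounded (\<lambda>x::'a::vector_lattice. 0 :: 'a)"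
  unfolding order_bounded_def by (intro allI exI[of _ 0]) auto

lemma order_bounded_id: "order_bounded (\<lambda>x::'a::vector_lattice. x)"
  unfolding order_bounded_def by (metis image_ident order_refl)

lemma order_bounded_add:
  fixes T U :: "'a::vector_lattice \<Rightarrow> 'a"
  assumes "order_bounded T" "order_bounded U"
  shows "order_bounded (\<lambda>x. T x + U x)"
  unfolding order_bounded_def
proof (intro allI)
  fix a b
  obtain c d c' d' where "T ` {a..b} \<subseteq> {c..d}" "U ` {a..b} \<subseteq> {c'..d'}"
    using assms unfolding order_bounded_def by metis
  then have "(\<lambda>x. T x + U x) ` {a..b} \<subseteq> {c + c'..d + d'}"
    by (auto intro!: add_mono simp: image_subset_iff)
  then show "\<exists>c d. (\<lambda>x. T x + U x) ` {a..b} \<subseteq> {c..d}" by blast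
qed

lemma order_bounded_uminus:
  fixes T :: "'a::vector_lattice \<Rightarrow> 'a"
  assumes "order_bounded T"
  shows "order_bounded (\<lambda>x. - T x)"
  unfolding order_bounded_def
proof (intro allI)
  fix a b
  obtain c d where "T ` {a..b} \<subseteq> {c..d}"
    using assms unfolding order_bounded_def by metis
  then have "(\<lambda>x. - T x) ` {a..b} \<subseteq> {- d..- c}"
    by (auto simp: image_subset_iff)
  then show "\<exists>c d. (\<lambda>x. - T x) ` {a..b} \<subseteq> {c..d}" by blast
qed

lemma order_bounded_scaleR:
  fixes T :: "'a::vector_lattice \<Rightarrow> 'a"
  assumes "order_bounded T"
  shows "order_bounded (\<lambda>x. k *\<^sub>R T x)"
proof -
  have *: "order_bounded (\<lambda>x. k *\<^sub>R T x)" if k: "k \<ge> 0" and T: "order_bounded T"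
    for k and T :: "'a \<Rightarrow> 'a"
    unfolding order_bounded_def
  proof (intro allI)
    fix a b
    obtain c d where "T ` {a..b} \<subseteq> {c..d}"
      using T unfolding order_bounded_def by metis
    then have "(\<lambda>x. k *\<^sub>R T x) ` {a..b} \<subseteq> {k *\<^sub>R c..k *\<^sub>R d}"
      using k by (auto intro!: scaleR_left_mono simp: image_subset_iff)
    then show "\<exists>c d. (\<lambda>x. k *\<^sub>R T x) ` {a..b} \<subseteq> {c..d}" by blast
  qed
  show ?thesis
    using *[of k T] *[of "- k" "\<lambda>x. - T x"] assms order_bounded_uminus[OF assms]
    by (cases "k \<ge> 0") auto
qed

typedef (overloaded) 'a ob_op =
  "{T :: 'a::dedekind_complete_vector_lattice \<Rightarrow> 'a. linear T \<and> order_bounded T}"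
  morphisms ob_apply Ob_op
proof
  show "(\<lambda>x. 0) \<in> {T :: 'a \<Rightarrow> 'a. linear T \<and> order_bounded T}"
    by (simp add: order_bounded_zero linear_iff)
qed

setup_lifting type_definition_ob_op

text \<open>The multiplication of operators is composition, and \<open>1\<close> is the identity operator.\<close>

instantiation ob_op :: (dedekind_complete_vector_lattice) "{real_algebra, monoid_mult}"
begin

lift_definition zero_ob_op :: "'a ob_op" is "\<lambda>x. 0"
  by (simp add: order_bounded_zero linear_iff)

lift_definition one_ob_op :: "'a ob_op" is "\<lambda>x. x"
  by (simp add: order_bounded_id linear_iff)

lift_definition plus_ob_op :: "'a ob_op \<Rightarrow> 'a ob_op \<Rightarrow> 'a ob_op" is "\<lambda>T U x. T x + U x"
  by (simp add: order_bounded_add linear_compose_add)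

lift_definition uminus_ob_op :: "'a ob_op \<Rightarrow> 'a ob_op" is "\<lambda>T x. - T x"
  by (simp add: order_bounded_uminus linear_compose_neg)

lift_definition minus_ob_op :: "'a ob_op \<Rightarrow> 'a ob_op \<Rightarrow> 'a ob_op" is "\<lambda>T U x. T x - U x"
  using order_bounded_add[OF _ order_bounded_uminus] by (fastforce simp: linear_compose_sub)

lift_definition scaleR_ob_op :: "real \<Rightarrow> 'a ob_op \<Rightarrow> 'a ob_op" is "\<lambda>k T x. k *\<^sub>R T x"
  by (simp add: order_bounded_scaleR linear_compose_scale_right)

lift_definition times_ob_op :: "'a ob_op \<Rightarrow> 'a ob_op \<Rightarrow> 'a ob_op" is "\<lambda>T U. T \<circ> U"
proof (intro conjI)
  fix T U :: "'a \<Rightarrow> 'a"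
  assume *: "linear T \<and> order_bounded T" "linear U \<and> order_bounded U"
  then show "linear (T \<circ> U)" by (simp add: linear_compose)
  show "order_bounded (T \<circ> U)"
    using * unfolding order_bounded_def image_comp[symmetric] by (meson image_mono order_trans)
qed

instance
  by standard (transfer; simp add: fun_eq_iff algebra_simps linear_add linear_scale)+

end

text \<open>The operator order: \<open>T \<le> U\<close> iff \<open>U - T\<close> is positive.\<close>

instantiation ob_op :: (dedekind_complete_vector_lattice) order
begin

lift_definition less_eq_ob_op :: "'a ob_op \<Rightarrow> 'a ob_op \<Rightarrow> bool" is
  "\<lambda>T U. \<forall>x\<ge>0. T x \<le> U x" .

definition less_ob_op :: "'a ob_op \<Rightarrow> 'a ob_op \<Rightarrow> bool" where
  "less_ob_op T U \<longleftrightarrow> T \<le> U \<and> \<not> U \<le> T"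

instance
proof
  fix T U V :: "'a ob_op"
  show "T < U \<longleftrightarrow> T \<le> U \<and> \<not> U \<le> T" by (rule less_ob_op_def)
  show "T \<le> T" by transfer simp
  show "T \<le> V" if "T \<le> U" "U \<le> V" using that by transfer (meson order_trans)
  show "T = U" if "T \<le> U" "U \<le> T" using that
  proof transfer
    fix T U :: "'a \<Rightarrow> 'a"
    assume lin: "linear T \<and> order_bounded T" "linear U \<and> order_bounded U"
      and "\<forall>x\<ge>0. T x \<le> U x" "\<forall>x\<ge>0. U x \<le> T x"
    then have eq: "T x = U x" if "x \<ge> 0" for x
      using that by (simp add: order_antisym)
    have "T x = U x" for x
    proof -
      have x: "x = pprt x - (- nprt x)" using prts[of x] by simp
      have "T x = T (pprt x) - T (- nprt x)"
        using lin by (subst x) (simp only: linear_diff)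
      moreover have "U x = U (pprt x) - U (- nprt x)"
        using lin by (subst x) (simp only: linear_diff)
      ultimately show ?thesis using eq by simp
    qed
    then show "T = U" by auto
  qed
qed

end

instance ob_op :: (dedekind_complete_vector_lattice) ordered_real_vector
  by standard (transfer; simp add: scaleR_left_mono scaleR_right_mono)+


subsection \<open>The lattice structure\<close>

text \<open>The Riesz--Kantorovich formula for the positive part, on the positive cone.\<close>

definition rk :: "('a::dedekind_complete_vector_lattice \<Rightarrow> 'a) \<Rightarrow> 'a \<Rightarrow> 'a" where
  "rk T x = Sup (T ` {0..x})"

lemma rk_upper:
  assumes "order_bounded T" "0 \<le> z" "z \<le> x"
  shows "T z \<le> rk T x"
proof -
  obtain c d where "T ` {0..x} \<subseteq> {c..d}"
    using assms(1) unfolding order_bounded_def by blast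
  then have "bdd_above (T ` {0..x})"
    by (meson bdd_above_Icc bdd_above_mono)
  then show ?thesis
    unfolding rk_def using assms by (intro cSup_upper) auto
qed

lemma rk_least:
  assumes "0 \<le> x" "\<And>z. 0 \<le> z \<Longrightarrow> z \<le> x \<Longrightarrow> T z \<le> u"
  shows "rk T x \<le> u"
  unfolding rk_def using assms by (intro cSup_least) auto

lemma rk_add:
  assumes T: "linear T" "order_bounded T" and xy: "0 \<le> x" "0 \<le> y"
  shows "rk T (x + y) = rk T x + rk T y"
proof (rule order_antisym)
  show "rk T (x + y) \<le> rk T x + rk T y"
  proof (rule rk_least)
    fix z assume z: "0 \<le> z" "z \<le> x + y"
    have "z - inf z x = sup 0 (z - x)"
      by (simp add: diff_inf_eq_sup add_sup_distrib_left)
    also have "\<dots> \<le> y"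
      using z xy by (simp add: algebra_simps)
    finally have 1: "z - inf z x \<le> y" .
    have 2: "0 \<le> z - inf z x"
      using inf_le1[of z x] by (simp only: diff_ge_0_iff_ge)
    have "T z = T (inf z x) + T (z - inf z x)"
      by (simp flip: linear_add[OF T(1)] del: diff_inf_eq_sup)
    also have "\<dots> \<le> rk T x + rk T y"
      using 1 2 z xy by (intro add_mono rk_upper T(2) inf_le2 inf_greatest)
    finally show "T z \<le> rk T x + rk T y" .
  qed (use xy in simp)
  have "rk T y \<le> rk T (x + y) - rk T x"
  proof (rule rk_least)
    fix w assume w: "0 \<le> w" "w \<le> y"
    have "rk T x \<le> rk T (x + y) - T w"
    proof (rule rk_least)
      fix z assume z: "0 \<le> z" "z \<le> x"
      have "T z + T w = T (z + w)" using T(1) by (simp add: linear_add)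
      also have "\<dots> \<le> rk T (x + y)"
        using z w by (intro rk_upper T(2) add_nonneg_nonneg add_mono)
      finally show "T z \<le> rk T (x + y) - T w" by (simp add: algebra_simps)
    qed (use xy in simp)
    then show "T w \<le> rk T (x + y) - rk T x" by (simp add: algebra_simps)
  qed (use xy in simp)
  then show "rk T x + rk T y \<le> rk T (x + y)" by (simp add: algebra_simps)
qed

lemma rk_scaleR:
  assumes T: "linear T" "order_bounded T" and x: "0 \<le> x" and k: "0 \<le> k"
  shows "rk T (k *\<^sub>R x) = k *\<^sub>R rk T x"
proof (cases "k = 0")
  case True
  then show ?thesis using T by (simp add: rk_def linear_0)
next
  case False
  have le: "k *\<^sub>R rk T x \<le> rk T (k *\<^sub>R x)" if k: "k > 0" and x: "0 \<le> x" for k :: real and x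
  proof -
    have "rk T x \<le> inverse k *\<^sub>R rk T (k *\<^sub>R x)"
    proof (rule rk_least)
      fix z assume z: "0 \<le> z" "z \<le> x"
      have "k *\<^sub>R T z = T (k *\<^sub>R z)" using T(1) by (simp add: linear_scale)
      also have "\<dots> \<le> rk T (k *\<^sub>R x)"
        using z k by (intro rk_upper T(2) scaleR_left_mono scaleR_nonneg_nonneg) auto
      finally have "inverse k *\<^sub>R k *\<^sub>R T z \<le> inverse k *\<^sub>R rk T (k *\<^sub>R x)"
        using k by (intro scaleR_left_mono) auto
      then show "T z \<le> inverse k *\<^sub>R rk T (k *\<^sub>R x)" using k by simp
    qed (use x in simp)
    then have "k *\<^sub>R rk T x \<le> k *\<^sub>R inverse k *\<^sub>R rk T (k *\<^sub>R x)"
      using k by (intro scaleR_left_mono) auto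
    then show ?thesis using k by simp
  qed
  have k0: "k > 0" using False k by simp
  have "inverse k *\<^sub>R rk T (k *\<^sub>R x) \<le> rk T (inverse k *\<^sub>R k *\<^sub>R x)"
    using k0 x by (intro le scaleR_nonneg_nonneg) auto
  then have "k *\<^sub>R inverse k *\<^sub>R rk T (k *\<^sub>R x) \<le> k *\<^sub>R rk T x"
    using k0 by (intro scaleR_left_mono) auto
  then have "rk T (k *\<^sub>R x) \<le> k *\<^sub>R rk T x" using k0 by simp
  with le[OF k0 x] show ?thesis by (rule order_antisym[rotated])
qed

lemma rk_diff:
  assumes T: "linear T" "order_bounded T" and uv: "0 \<le> u" "0 \<le> v"
  shows "rk T (pprt (u - v)) - rk T (- nprt (u - v)) = rk T u - rk T v"
proof -
  have "pprt (u - v) + v = u + - nprt (u - v)"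
    using prts[of "u - v"] by (simp add: algebra_simps)
  then have "rk T (pprt (u - v)) + rk T v = rk T u + rk T (- nprt (u - v))"
    using uv by (metis rk_add[OF T] zero_le_pprt nprt_le_zero neg_0_le_iff_le)
  then show ?thesis by (simp add: algebra_simps)
qed

lift_definition ob_pos_part ::
  "'a::dedekind_complete_vector_lattice ob_op \<Rightarrow> 'a ob_op"
  is "\<lambda>T x. rk T (pprt x) - rk T (- nprt x)"
proof (intro conjI)
  fix T :: "'a \<Rightarrow> 'a"
  assume "linear T \<and> order_bounded T"
  then have T: "linear T" "order_bounded T" by auto
  let ?Q = "\<lambda>x. rk T (pprt x) - rk T (- nprt x)"
  have pn: "x = pprt x - (- nprt x)" "0 \<le> pprt x" "0 \<le> - nprt x" for x :: 'a
    using prts[of x] by auto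
  have Qadd: "?Q (x + y) = ?Q x + ?Q y" for x y
  proof -
    have "x + y = (pprt x + pprt y) - (- nprt x + - nprt y)"
      using arg_cong2[OF prts[of x] prts[of y], of "(+)"] by (simp add: ac_simps)
    then have "?Q (x + y) = rk T (pprt x + pprt y) - rk T (- nprt x + - nprt y)"
      using rk_diff[OF T, of "pprt x + pprt y" "- nprt x + - nprt y"] pn
      by (metis add_nonneg_nonneg)
    also have "\<dots> = rk T (pprt x) + rk T (pprt y) - (rk T (- nprt x) + rk T (- nprt y))"
      using rk_add[OF T pn(2) pn(2)] rk_add[OF T pn(3) pn(3)] by simp
    finally show ?thesis by (simp add: algebra_simps)
  qed
  have Qscale: "?Q (k *\<^sub>R x) = k *\<^sub>R ?Q x" if "k \<ge> 0" for k :: real and x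
  proof -
    have "k *\<^sub>R x = k *\<^sub>R pprt x - k *\<^sub>R (- nprt x)"
      using pn(1)[of x] by (metis scaleR_diff_right)
    then have "?Q (k *\<^sub>R x) = rk T (k *\<^sub>R pprt x) - rk T (k *\<^sub>R (- nprt x))"
      using rk_diff[OF T, of "k *\<^sub>R pprt x" "k *\<^sub>R (- nprt x)"] pn that
      by (metis scaleR_nonneg_nonneg)
    also have "\<dots> = k *\<^sub>R rk T (pprt x) - k *\<^sub>R rk T (- nprt x)"
      using rk_scaleR[OF T pn(2) that] rk_scaleR[OF T pn(3) that] by simp
    finally show ?thesis by (simp add: scaleR_diff_right)
  qed
  have Qneg: "?Q (- x) = - ?Q x" for x
    by (simp add: pprt_neg nprt_neg)
  show lin: "linear ?Q"
  proof (rule linearI)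
    fix k :: real and x
    show "?Q (k *\<^sub>R x) = k *\<^sub>R ?Q x"
    proof (cases "k \<ge> 0")
      case False
      then have "?Q (- (k *\<^sub>R x)) = - (k *\<^sub>R ?Q x)"
        using Qscale[of "- k" x] by simp
      then show ?thesis
        unfolding Qneg[of "k *\<^sub>R x"] by (rule neg_equal_iff_equal[THEN iffD1])
    qed (rule Qscale)
  qed (rule Qadd)
  have Qpos: "0 \<le> ?Q x" if "0 \<le> x" for x
    using that rk_upper[OF T(2), of 0 x] rk_least[of 0 T 0] linear_0[OF T(1)]
    by (simp add: rk_def)
  have Qmono: "?Q x \<le> ?Q y" if "x \<le> y" for x y
  proof -
    have "0 \<le> ?Q (y - x)" using that by (intro Qpos) simp
    then show ?thesis unfolding linear_diff[OF lin] diff_ge_0_iff_ge .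
  qed
  show "order_bounded ?Q"
    unfolding order_bounded_def
  proof (intro allI exI)
    fix a b
    show "?Q ` {a..b} \<subseteq> {?Q a..?Q b}" using Qmono by auto
  qed
qed

lemma ob_pos_part_apply:
  "0 \<le> x \<Longrightarrow> ob_apply (ob_pos_part T) x = rk (ob_apply T) x"
  by transfer (simp add: rk_def linear_0)

lemma ob_pos_part_ge: "T \<le> ob_pos_part T"
  unfolding less_eq_ob_op.rep_eq
  using ob_apply[of T] by (auto simp: ob_pos_part_apply intro: rk_upper)

lemma ob_pos_part_nonneg: "0 \<le> ob_pos_part T"
  unfolding less_eq_ob_op.rep_eq zero_ob_op.rep_eq
proof (intro allI impI)
  fix x :: 'a assume "0 \<le> x"
  then show "0 \<le> ob_apply (ob_pos_part T) x"
    using ob_apply[of T] rk_upper[of "ob_apply T" 0 x]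
    by (simp add: ob_pos_part_apply linear_0)
qed

lemma ob_pos_part_least:
  assumes "T \<le> U" "0 \<le> U"
  shows "ob_pos_part T \<le> U"
  unfolding less_eq_ob_op.rep_eq
proof (intro allI impI)
  fix x :: 'a assume x: "0 \<le> x"
  have lin: "linear (ob_apply U)" using ob_apply[of U] by simp
  have "rk (ob_apply T) x \<le> ob_apply U x"
  proof (rule rk_least[OF x])
    fix z assume z: "0 \<le> z" "z \<le> x"
    have "0 \<le> ob_apply U (x - z)"
      using assms(2) z by (simp add: less_eq_ob_op.rep_eq zero_ob_op.rep_eq)
    then have "ob_apply U z \<le> ob_apply U x" by (simp add: linear_diff[OF lin])
    moreover have "ob_apply T z \<le> ob_apply U z"
      using assms(1) z by (simp add: less_eq_ob_op.rep_eq)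
    ultimately show "ob_apply T z \<le> ob_apply U x" by simp
  qed
  then show "ob_apply (ob_pos_part T) x \<le> ob_apply U x"
    using x by (simp add: ob_pos_part_apply)
qed

instantiation ob_op :: (dedekind_complete_vector_lattice) vector_lattice
begin

definition sup_ob_op :: "'a ob_op \<Rightarrow> 'a ob_op \<Rightarrow> 'a ob_op" where
  "sup_ob_op T U = U + ob_pos_part (T - U)"

definition inf_ob_op :: "'a ob_op \<Rightarrow> 'a ob_op \<Rightarrow> 'a ob_op" where
  "inf_ob_op T U = T - ob_pos_part (T - U)"

definition abs_ob_op :: "'a ob_op \<Rightarrow> 'a ob_op" where
  "abs_ob_op T = sup T (- T)"

instance
proof
  fix T U V :: "'a ob_op"
  show "T \<le> sup T U"
    using ob_pos_part_ge[of "T - U"] by (simp add: sup_ob_op_def algebra_simps)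
  show "U \<le> sup T U"
    using ob_pos_part_nonneg[of "T - U"] by (simp add: sup_ob_op_def)
  show "sup U V \<le> T" if "U \<le> T" "V \<le> T"
    using ob_pos_part_least[of "U - V" "T - V"] that by (simp add: sup_ob_op_def algebra_simps)
  show "inf T U \<le> T"
    using ob_pos_part_nonneg[of "T - U"] by (simp add: inf_ob_op_def)
  show "inf T U \<le> U"
    using ob_pos_part_ge[of "T - U"] by (simp add: inf_ob_op_def algebra_simps)
  show "T \<le> inf U V" if "T \<le> U" "T \<le> V"
    using ob_pos_part_least[of "U - V" "U - T"] that by (simp add: inf_ob_op_def algebra_simps)
  show "\<bar>T\<bar> = sup T (- T)" by (rule abs_ob_op_def)
qed

end


section \<open>Classes of operators and commutants\<close>

text \<open>
  Order continuous linear operators on a Dedekind complete vector lattice are order bounded, so that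
  nothing is lost by collecting them in the type \<^typ>\<open>'a ob_op\<close>. Membership of an order bounded
  operator only asks for the preservation of order convergence for nets indexed in \<^typ>\<open>'a\<close>, so
  that every order continuous operator in the sense of arbitrary nets is certainly included.
\<close>

definition L_oc :: "'a::dedekind_complete_vector_lattice ob_op set" where
  "L_oc = {T. order_continuous UNIV UNIV (ob_apply T)}"

definition Orth :: "'a::dedekind_complete_vector_lattice ob_op set" where
  "Orth = {T. \<forall>B. band UNIV B \<longrightarrow> ob_apply T ` B \<subseteq> B}"

definition orth_commutant ::
  "'a::dedekind_complete_vector_lattice ob_op set \<Rightarrow> 'a ob_op set" where
  "orth_commutant X = {T \<in> Orth. \<forall>S\<in>X. T * S = S * T}"

text \<open>
  \<open>A\<close> is meant to be a vector lattice algebra that is itself a vector sublattice of the order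
  bounded operators, such as \<^const>\<open>Orth\<close>.
\<close>

definition vector_lattice_subalgebra ::
  "'a::dedekind_complete_vector_lattice ob_op set \<Rightarrow> 'a ob_op set \<Rightarrow> bool" where
  "vector_lattice_subalgebra A H \<longleftrightarrow>
     H \<subseteq> A \<and> vector_sublattice H \<and> (\<forall>T\<in>H. \<forall>U\<in>H. T * U \<in> H)"

end

theory Submission
  imports Defs
begin

text \<open>
  The idea is to treat multiplication by an orthomorphism \<open>T\<close> as an orthomorphism again. The space of
  order bounded operators on \<open>E\<close> is itself a Dedekind complete vector lattice, and \<open>S \<mapsto> T S\<close> and
  \<open>S \<mapsto> S T\<close> are orthomorphisms on it (\<open>multiplication_in_Orth\<close>). The operators that commute with \<open>T\<close>
  are the kernel of their difference, and the kernel of an orthomorphism is a band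
  (\<open>band_Orth_kernel\<close>). So whatever commutes with \<open>\<S>\<close> commutes with the band generated by \<open>\<S>\<close>.

  The delicate point is \<open>S \<mapsto> S T\<close>, since \<open>S\<close> need not be order continuous, and truncating \<open>T\<close> to
  multiples of the identity is of no use on that side. Instead, an orthomorphism \<open>T \<ge> 1\<close> has a
  positive inverse (\<open>Orth_inverse\<close>). Both multiplications by \<open>T\<close> are then lattice automorphisms; as
  they enlarge positive operators, they preserve disjointness with any fixed operator. A general
  \<open>T\<close> is dominated by \<open>\<bar>T\<bar> + 1\<close>.

  The commutant is a sublattice because a positive \<open>S\<close> commuting with \<open>T\<close> satisfies
  \<open>T\<^sup>+ S - T\<^sup>- S = S T\<^sup>+ - S T\<^sup>-\<close>, where both sides are differences of disjoint positive operators, so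
  that \<open>T\<^sup>+ S = S T\<^sup>+\<close> (\<open>commute_pprt_nonneg\<close>); the operators commuting with \<open>T\<close> forming an ideal, one
  may pass to positive \<open>S\<close>. The identity is a weak order unit because \<open>n (T - n)\<^sup>+ \<le> T\<^sup>2\<close> for \<open>T \<ge> 0\<close>
  makes the truncations of \<open>T\<close> converge to \<open>T\<close> inside the commutant.

  If \<open>\<S>\<close> consists of order continuous operators, then the commutant is order closed in the space of
  all operators (\<open>order_closed_orth_commutant\<close>). Any order closed sublattice of a Dedekind complete
  vector lattice is Dedekind complete, is order closed in the regular sublattices containing it, and
  is regular in them, since suprema and infima in the whole space stay in it.
\<close>

section \<open>Disjointness in vector lattices\<close>

definition disjoint :: "'g::vector_lattice \<Rightarrow> 'g \<Rightarrow> bool" (infix \<open>\<perp>\<close> 50) where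
  "x \<perp> y \<longleftrightarrow> inf (\<bar>x\<bar>) (\<bar>y\<bar>) = 0"

lemma disjoint_sym: "x \<perp> y \<Longrightarrow> y \<perp> x"
  by (simp add: disjoint_def inf_commute)

lemma disjoint_nonneg_iff: "0 \<le> x \<Longrightarrow> 0 \<le> y \<Longrightarrow> x \<perp> y \<longleftrightarrow> inf x y = 0"
  by (simp add: disjoint_def)

lemma disjoint_zero [simp]: "0 \<perp> y" "y \<perp> 0"
  by (simp_all add: disjoint_def inf_absorb1 inf_absorb2)

lemma disjoint_abs_iff [simp]: "\<bar>x\<bar> \<perp> y \<longleftrightarrow> x \<perp> y" "x \<perp> \<bar>y\<bar> \<longleftrightarrow> x \<perp> y"
  by (simp_all add: disjoint_def)

lemma disjoint_uminus_iff [simp]: "- x \<perp> y \<longleftrightarrow> x \<perp> y" "x \<perp> - y \<longleftrightarrow> x \<perp> y"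
  by (simp_all add: disjoint_def)

lemma disjoint_mono:
  assumes "x' \<perp> y'" "\<bar>x\<bar> \<le> \<bar>x'\<bar>" "\<bar>y\<bar> \<le> \<bar>y'\<bar>"
  shows "x \<perp> y"
proof -
  have "inf (\<bar>x\<bar>) (\<bar>y\<bar>) \<le> inf (\<bar>x'\<bar>) (\<bar>y'\<bar>)"
    using assms(2,3) by (rule inf_mono)
  moreover have "0 \<le> inf (\<bar>x\<bar>) (\<bar>y\<bar>)" by simp
  ultimately show ?thesis
    using assms(1) unfolding disjoint_def by (simp only: order_antisym)
qed

lemma disjoint_self: "x \<perp> x \<Longrightarrow> x = 0"
  by (simp add: disjoint_def)

lemma inf_add_le:
  fixes a b c :: "'g::vector_lattice"
  assumes "0 \<le> a" "0 \<le> b" "0 \<le> c"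
  shows "inf (a + b) c \<le> inf a c + inf b c"
proof -
  let ?m = "inf (a + b) c"
  have "?m \<le> a + b" "?m \<le> c"
    by simp_all
  then have "?m \<le> a + inf b c" "?m \<le> c + inf b c"
    using assms unfolding add_inf_distrib_left
    by (auto intro!: le_infI intro: order_trans[of _ c] simp: add_increasing add_increasing2)
  then show ?thesis
    unfolding add_inf_distrib_right by (rule inf_greatest)
qed

lemma disjoint_add:
  assumes "x \<perp> z" "y \<perp> z"
  shows "x + y \<perp> z"
proof -
  have "inf (\<bar>x + y\<bar>) (\<bar>z\<bar>) \<le> inf (\<bar>x\<bar> + \<bar>y\<bar>) (\<bar>z\<bar>)"
    by (intro inf_mono abs_triangle_ineq order_refl)
  also have "\<dots> \<le> inf (\<bar>x\<bar>) (\<bar>z\<bar>) + inf (\<bar>y\<bar>) (\<bar>z\<bar>)"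
    by (intro inf_add_le) auto
  finally show ?thesis
    using assms by (simp add: disjoint_def order_antisym)
qed

lemma disjoint_diff: "x \<perp> z \<Longrightarrow> y \<perp> z \<Longrightarrow> x - y \<perp> z"
  using disjoint_add[of x z "- y"] by simp

lemma scaleR_inf:
  fixes x y :: "'g::vector_lattice"
  assumes "0 \<le> k"
  shows "k *\<^sub>R inf x y = inf (k *\<^sub>R x) (k *\<^sub>R y)"
proof (cases "k = 0")
  case False
  then have k: "k > 0" using assms by simp
  let ?m = "inf (k *\<^sub>R x) (k *\<^sub>R y)"
  have "inverse k *\<^sub>R ?m \<le> inverse k *\<^sub>R k *\<^sub>R x" "inverse k *\<^sub>R ?m \<le> inverse k *\<^sub>R k *\<^sub>R y"
    using k by (intro scaleR_left_mono; simp)+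
  then have "k *\<^sub>R inverse k *\<^sub>R ?m \<le> k *\<^sub>R inf x y"
    using k by (intro scaleR_left_mono inf_greatest) simp_all
  then have "?m \<le> k *\<^sub>R inf x y"
    using k by simp
  moreover have "k *\<^sub>R inf x y \<le> ?m"
    using k by (intro inf_greatest scaleR_left_mono) simp_all
  ultimately show ?thesis by (rule order_antisym[rotated])
qed simp

lemma abs_scaleR_le:
  fixes x :: "'g::vector_lattice"
  shows "\<bar>k *\<^sub>R x\<bar> \<le> \<bar>k\<bar> *\<^sub>R \<bar>x\<bar>"
proof -
  have *: "\<bar>k *\<^sub>R x\<bar> \<le> k *\<^sub>R \<bar>x\<bar>" if "0 \<le> k" for k and x :: 'g
  proof (rule abs_leI)
    show "k *\<^sub>R x \<le> k *\<^sub>R \<bar>x\<bar>"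
      using that by (intro scaleR_left_mono abs_ge_self)
    have "k *\<^sub>R (- x) \<le> k *\<^sub>R \<bar>x\<bar>"
      using that by (intro scaleR_left_mono abs_ge_minus_self)
    then show "- (k *\<^sub>R x) \<le> k *\<^sub>R \<bar>x\<bar>" by simp
  qed
  show ?thesis
    using *[of k x] *[of "- k" "- x"] by (cases "0 \<le> k") auto
qed

lemma disjoint_scaleR:
  assumes "x \<perp> y"
  shows "k *\<^sub>R x \<perp> y"
proof -
  have "\<bar>k *\<^sub>R x\<bar> \<le> (\<bar>k\<bar> + 1) *\<^sub>R \<bar>x\<bar>"
    using abs_scaleR_le[of k x] by (simp add: scaleR_left_distrib add_increasing2)
  moreover have "\<bar>y\<bar> \<le> (\<bar>k\<bar> + 1) *\<^sub>R \<bar>y\<bar>"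
    by (simp add: scaleR_left_distrib scaleR_nonneg_nonneg)
  ultimately have "inf (\<bar>k *\<^sub>R x\<bar>) (\<bar>y\<bar>) \<le> (\<bar>k\<bar> + 1) *\<^sub>R inf (\<bar>x\<bar>) (\<bar>y\<bar>)"
    unfolding scaleR_inf[of "\<bar>k\<bar> + 1", simplified] by (rule inf_mono)
  then show ?thesis
    using assms by (simp add: disjoint_def order_antisym)
qed

lemma disjoint_add_eq_sup: "inf x y = 0 \<Longrightarrow> x + y = sup x (y::'g::vector_lattice)"
  using add_eq_inf_sup[of x y] by simp

lemma pprt_diff_disjoint:
  fixes a b :: "'g::vector_lattice"
  assumes "inf a b = 0"
  shows "pprt (a - b) = a"
proof -
  have "pprt (a - b) + b = sup a b"
    by (simp add: pprt_def add_sup_distrib_right)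
  then show ?thesis
    using disjoint_add_eq_sup[OF assms] by (metis add_right_cancel)
qed

text \<open>
  An element has only one decomposition as a difference of disjoint positive elements, namely the one
  into its positive and negative parts. The proof that commutants are sublattices compares two such
  decompositions of one operator.
\<close>
lemma disjoint_decomposition_unique:
  fixes a b c d :: "'g::vector_lattice"
  assumes "inf a b = 0" "inf c d = 0" "a - b = c - d"
  shows "a = c"
  using assms pprt_diff_disjoint by metis

lemma inf_pprt_nprt: "inf (pprt x) (- nprt x) = (0::'g::vector_lattice)"
proof -
  have "inf (pprt x) (- nprt x) = inf (x - nprt x) (- nprt x)"
    using prts[of x] by (metis add_diff_cancel_right')
  also have "\<dots> = inf x 0 - nprt x"
    using add_inf_distrib_right[of x 0 "- nprt x"] by simp
  finally show ?thesis
    by (simp add: nprt_def del: diff_inf_eq_sup)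
qed

lemma disjoint_pprt_nprt: "pprt x \<perp> nprt x"
  using inf_pprt_nprt[of x] disjoint_nonneg_iff[of "pprt x" "- nprt x"] by simp

lemma pprt_le_abs: "pprt x \<le> \<bar>x::'g::vector_lattice\<bar>"
  by (simp add: pprt_def abs_ge_self)

lemma minus_nprt_le_abs: "- nprt x \<le> \<bar>x::'g::vector_lattice\<bar>"
  by (simp add: nprt_def abs_ge_minus_self)

lemma pprt_minus_nprt: "pprt x - (- nprt x) = (x::'g::vector_lattice)"
  using prts[of x] by simp

lemma pprt_least: "x \<le> u \<Longrightarrow> 0 \<le> u \<Longrightarrow> pprt x \<le> (u::'g::vector_lattice)"
  by (simp add: pprt_def)

lemma le_pprt: "x \<le> pprt (x::'g::vector_lattice)"
  by (simp add: pprt_def)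

lemma disjoint_prts_iff: "x \<perp> y \<longleftrightarrow> pprt x \<perp> y \<and> nprt x \<perp> y"
proof
  assume "x \<perp> y"
  then show "pprt x \<perp> y \<and> nprt x \<perp> y"
    using disjoint_mono[of x y "pprt x" y] disjoint_mono[of x y "nprt x" y]
      pprt_le_abs[of x] minus_nprt_le_abs[of x] by simp
next
  assume "pprt x \<perp> y \<and> nprt x \<perp> y"
  then show "x \<perp> y"
    using disjoint_add[of "pprt x" y "nprt x"] prts[of x] by simp
qed

lemma Archimedean_le_zero:
  fixes x y :: "'a::dedekind_complete_vector_lattice"
  assumes "\<And>n. 0 < n \<Longrightarrow> real n *\<^sub>R x \<le> y"
  shows "x \<le> 0"
proof -
  define X where "X = (\<lambda>n. real (Suc n) *\<^sub>R x) ` UNIV"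
  have bdd: "bdd_above X"
    unfolding X_def using assms by (intro bdd_aboveI[of _ y]) (auto simp del: of_nat_Suc)
  \<comment> \<open>Adding \<open>x\<close> to a multiple gives another multiple, so the supremum could be lowered by \<open>x\<close>.\<close>
  have "Sup X \<le> Sup X - x"
  proof (rule cSup_least)
    fix v assume "v \<in> X"
    then obtain n where v: "v = real (Suc n) *\<^sub>R x"
      unfolding X_def by blast
    have "v + x = real (Suc (Suc n)) *\<^sub>R x"
      unfolding v of_nat_Suc[of "Suc n"] by (simp add: scaleR_left_distrib del: of_nat_Suc)
    also have "\<dots> \<le> Sup X"
      unfolding X_def using bdd[unfolded X_def] by (intro cSup_upper rangeI)
    finally show "v \<le> Sup X - x" by (simp add: algebra_simps)
  qed (simp add: X_def)
  then show ?thesis by (simp add: algebra_simps)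
qed

lemma disjoint_Sup:
  fixes y :: "'a::dedekind_complete_vector_lattice"
  assumes X: "X \<noteq> {}" "bdd_above X" and disj: "\<And>x. x \<in> X \<Longrightarrow> x \<perp> y"
  shows "Sup X \<perp> y"
proof -
  let ?s = "Sup X"
  let ?c = "inf (pprt ?s) (\<bar>y\<bar>)"
  have c0: "?c \<ge> 0" by simp
  \<comment> \<open>Disjoint positive elements below \<open>pprt ?s\<close> have their sum below it, so that \<open>?s\<close> could be
    lowered by \<open>?c\<close>.\<close>
  have "x \<le> pprt ?s - ?c" if x: "x \<in> X" for x
  proof -
    have px: "pprt x \<le> pprt ?s"
      using cSup_upper[OF x X(2)] by simp
    have "inf (pprt x) ?c \<le> inf (pprt x) (\<bar>y\<bar>)"
      by (intro inf_mono) auto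
    also have "\<dots> = 0"
      using disj[OF x] by (simp add: disjoint_prts_iff[of x] disjoint_def[of "pprt x"])
    finally have "inf (pprt x) ?c = 0"
      using c0 by (intro order_antisym) auto
    then have "pprt x + ?c = sup (pprt x) ?c"
      by (rule disjoint_add_eq_sup)
    also have "\<dots> \<le> pprt ?s"
      using px by simp
    finally have "pprt x \<le> pprt ?s - ?c"
      by (simp only: le_diff_eq)
    then show ?thesis
      using le_pprt order_trans by blast
  qed
  then have "?s \<le> pprt ?s - ?c"
    by (intro cSup_least X)
  moreover have "0 \<le> pprt ?s - ?c"
    by (simp del: diff_inf_eq_sup)
  ultimately have "pprt ?s \<le> pprt ?s - ?c"
    by (rule pprt_least)
  then have "?c \<le> 0"
    by (simp only: le_diff_eq add_le_same_cancel1)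
  then have "pprt ?s \<perp> y"
    using c0 by (simp add: disjoint_def order_antisym)
  moreover have "nprt ?s \<perp> y"
  proof -
    obtain x where x: "x \<in> X" using X(1) by blast
    have "nprt x \<le> nprt ?s"
      using cSup_upper[OF x X(2)] by simp
    then show ?thesis
      using disj[OF x] by (intro disjoint_mono[of "nprt x" y "nprt ?s" y]) (auto simp: disjoint_prts_iff[of x])
  qed
  ultimately show ?thesis
    by (simp add: disjoint_prts_iff[of ?s])
qed

section \<open>Decomposition along a band\<close>

text \<open>
  The projection theorem for the band of all elements disjoint from \<open>w\<close>. The part \<open>x2\<close> lies in the
  band generated by \<open>w\<close>, and this is expressed through its double disjoint complement, since
  disjointness is all that orthomorphisms are going to be tested on.
\<close>
lemma disjoint_band_decomposition:
  fixes w x :: "'a::dedekind_complete_vector_lattice"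
  assumes x: "0 \<le> x"
  obtains x1 x2 where "x = x1 + x2" "0 \<le> x1" "0 \<le> x2" "x1 \<perp> w"
    "\<And>c. c \<perp> w \<Longrightarrow> x2 \<perp> c"
proof -
  define W where "W = {v. 0 \<le> v \<and> v \<le> x \<and> v \<perp> w}"
  have W0: "0 \<in> W" using x by (simp add: W_def)
  have bdd: "bdd_above W" by (auto simp: W_def intro: bdd_aboveI)
  have s0: "0 \<le> Sup W" by (intro cSup_upper W0 bdd)
  have sx: "Sup W \<le> x" using W0 by (intro cSup_least) (auto simp: W_def)
  have sw: "Sup W \<perp> w" using W0 bdd by (intro disjoint_Sup) (auto simp: W_def)
  have "x - Sup W \<perp> c" if c: "c \<perp> w" for c
  proof -
    let ?v = "inf (x - Sup W) (\<bar>c\<bar>)"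
    have v0: "0 \<le> ?v" using sx by simp
    have "?v \<perp> w" using c v0 by (intro disjoint_mono[of c w ?v w]) auto
    then have "u \<le> Sup W - ?v" if u: "u \<in> W" for u
    proof -
      have "u \<le> Sup W" by (intro cSup_upper u bdd)
      then have "u + ?v \<le> Sup W + (x - Sup W)" by (intro add_mono) simp_all
      then have "u + ?v \<in> W"
        using u v0 \<open>?v \<perp> w\<close> by (auto simp: W_def intro: disjoint_add)
      then show ?thesis
        using cSup_upper[OF _ bdd] by (simp only: le_diff_eq)
    qed
    then have "Sup W \<le> Sup W - ?v" using W0 by (intro cSup_least) auto
    then have "?v \<le> 0" by (simp only: le_diff_eq add_le_same_cancel1)
    then show ?thesis
      using v0 sx by (simp add: disjoint_def order_antisym)
  qed
  then show thesis
    using that[of "Sup W" "x - Sup W"] s0 sx sw by simp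
qed

lemma pprt_add_disjoint_le:
  fixes a b :: "'g::vector_lattice"
  assumes "a \<perp> b"
  shows "pprt a \<le> pprt (a + b)"
proof -
  have "pprt a \<perp> nprt b"
    using assms disjoint_prts_iff[of a b] disjoint_prts_iff[of b "pprt a"] disjoint_sym by blast
  then have "inf (pprt a) (- nprt b) = 0"
    using disjoint_nonneg_iff[of "pprt a" "- nprt b"] by simp
  then have "pprt (pprt a + nprt b) = pprt a"
    using pprt_diff_disjoint[of "pprt a" "- nprt b"] by simp
  moreover have "nprt b \<le> b" by (simp add: nprt_def)
  moreover have "pprt a + nprt b \<le> pprt (a + b)"
  proof -
    have "pprt a + nprt b = sup (a + nprt b) (nprt b)"
      by (simp add: pprt_def add_sup_distrib_right)
    also have "\<dots> \<le> pprt (a + b)"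
      using \<open>nprt b \<le> b\<close> by (auto simp: pprt_def intro: le_supI1 add_left_mono le_supI2)
    finally show ?thesis .
  qed
  ultimately show ?thesis
    by (metis pprt_least zero_le_pprt)
qed

text \<open>
  A decomposition along the positive part \<open>pprt (a + b)\<close> separates the signs: the component \<open>a\<close>
  disjoint from the positive part can have no positive part itself, and the negative part of the
  component \<open>b\<close> is dominated by the negative part of \<open>a + b\<close>, which is disjoint from \<open>b\<close>.
\<close>
lemma split_signs:
  fixes a b :: "'g::vector_lattice"
  assumes "a \<perp> pprt (a + b)" "\<And>c. c \<perp> pprt (a + b) \<Longrightarrow> b \<perp> c"
  shows "a \<le> 0" "0 \<le> b"
proof -
  have ab: "a \<perp> b" using assms by (blast intro: disjoint_sym)
  have "pprt a \<le> pprt (a + b)" by (rule pprt_add_disjoint_le[OF ab])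
  then have "pprt a \<perp> pprt a"
    using assms(1) by (intro disjoint_mono[of "pprt a" "pprt (a + b)" "pprt a" "pprt a"]) (auto simp: disjoint_prts_iff[of a])
  then have "pprt a = 0" by (rule disjoint_self)
  then show "a \<le> 0" using le_zero_iff_zero_pprt by blast
  have "pprt (- b) \<le> pprt (- b + - a)"
    using ab by (intro pprt_add_disjoint_le) (simp add: disjoint_sym)
  also have "\<dots> = - nprt (a + b)" using pprt_neg[of "a + b"] by (simp add: algebra_simps)
  finally have "- nprt b \<le> - nprt (a + b)" by (simp add: pprt_neg)
  moreover have "nprt (a + b) \<perp> b"
    using assms(2)[OF disjoint_sym[OF disjoint_pprt_nprt]] by (rule disjoint_sym)
  ultimately have "nprt b \<perp> nprt b"
    using disjoint_prts_iff[of b "nprt (a + b)"]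
    by (intro disjoint_mono[of "nprt (a + b)" "nprt b" "nprt b" "nprt b"]) (auto dest: disjoint_sym)
  then have "nprt b = 0" by (rule disjoint_self)
  then show "0 \<le> b" using zero_le_iff_zero_nprt by blast
qed

section \<open>Order convergence and bands\<close>

lemma isLub_iff:
  "isLub G X s \<longleftrightarrow> s \<in> G \<and> (\<forall>x\<in>X. x \<le> s) \<and> (\<forall>u\<in>G. (\<forall>x\<in>X. x \<le> u) \<longrightarrow> s \<le> u)"
  by (auto simp: isLub_def leastP_def isUb_def setle_def setge_def)

lemma isGlb_iff:
  "isGlb G X s \<longleftrightarrow> s \<in> G \<and> (\<forall>x\<in>X. s \<le> x) \<and> (\<forall>u\<in>G. (\<forall>x\<in>X. u \<le> x) \<longrightarrow> u \<le> s)"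
  by (auto simp: isGlb_def greatestP_def isLb_def setle_def setge_def)

definition upward_directed :: "'g::order set \<Rightarrow> bool" where
  "upward_directed D \<longleftrightarrow> D \<noteq> {} \<and> (\<forall>a\<in>D. \<forall>b\<in>D. \<exists>c\<in>D. a \<le> c \<and> b \<le> c)"

lemma order_converges_Sup:
  fixes D :: "'a::dedekind_complete_vector_lattice set"
  assumes "upward_directed D" "bdd_above D"
  shows "order_converges UNIV D (\<le>) (\<lambda>x. x) (Sup D)"
proof -
  have dir: "directed D (\<le>)"
    using assms(1) unfolding directed_def upward_directed_def
    by (auto simp: reflp_on_def transp_on_def)
  have up: "a \<le> Sup D" if "a \<in> D" for a
    using that assms(2) by (rule cSup_upper)
  have "u \<le> 0" if u: "\<And>a. a \<in> D \<Longrightarrow> u \<le> Sup D - a" for u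
  proof -
    have "Sup D \<le> Sup D - u"
      using assms(1) u by (intro cSup_least) (auto simp: upward_directed_def algebra_simps)
    then show ?thesis by (simp add: algebra_simps)
  qed
  then have dec: "decreases_to_zero UNIV D (\<le>) (\<lambda>a. Sup D - a)"
    using dir up unfolding decreases_to_zero_def isGlb_iff by (auto simp: diff_left_mono)
  show ?thesis
  proof (rule order_convergesI[OF dir _ _ dec])
    fix b assume b: "b \<in> D"
    have "\<bar>Sup D - a\<bar> \<le> Sup D - b" if "a \<in> D" "b \<le> a" for a
      using up[OF that(1)] that(2) by (simp add: diff_left_mono)
    then show "\<exists>a\<in>D. \<forall>a'\<in>D. a \<le> a' \<longrightarrow> \<bar>Sup D - a'\<bar> \<le> Sup D - b"
      using b by blast
  qed auto
qed

lemma order_closed_Sup: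
  fixes D :: "'a::dedekind_complete_vector_lattice set"
  assumes "order_closed UNIV H" "D \<subseteq> H" "upward_directed D" "bdd_above D"
  shows "Sup D \<in> H"
  using order_closedD[OF assms(1) order_converges_Sup[OF assms(3,4)]] assms(2) by auto

text \<open>
  The sets that dominate order convergent nets. Working with the set of values of a dominating net
  rather than with the net itself frees the arguments below from index sets.
\<close>
definition down_to_zero :: "'g::vector_lattice set \<Rightarrow> bool" where
  "down_to_zero Y \<longleftrightarrow> Y \<noteq> {} \<and> (\<forall>c\<in>Y. 0 \<le> c) \<and> (\<forall>c\<in>Y. \<forall>d\<in>Y. \<exists>e\<in>Y. e \<le> c \<and> e \<le> d) \<and>
     (\<forall>u. (\<forall>c\<in>Y. u \<le> c) \<longrightarrow> u \<le> 0)"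

lemma down_to_zeroD:
  assumes "down_to_zero Y"
  shows "Y \<noteq> {}" "c \<in> Y \<Longrightarrow> 0 \<le> c" "c \<in> Y \<Longrightarrow> d \<in> Y \<Longrightarrow> \<exists>e\<in>Y. e \<le> c \<and> e \<le> d"
    "(\<And>c. c \<in> Y \<Longrightarrow> u \<le> c) \<Longrightarrow> u \<le> 0"
  using assms unfolding down_to_zero_def by blast+

lemma order_convergesE:
  assumes "order_converges UNIV A r x l"
  obtains Y where "down_to_zero Y"
    "\<And>c. c \<in> Y \<Longrightarrow> \<exists>a\<in>A. \<forall>a'\<in>A. r a a' \<longrightarrow> \<bar>l - x a'\<bar> \<le> c"
proof -
  obtain B :: "'a set" and s y where y: "decreases_to_zero UNIV B s y"
    and dom: "\<forall>b\<in>B. \<exists>a\<in>A. \<forall>a'\<in>A. r a a' \<longrightarrow> \<bar>l - x a'\<bar> \<le> y b"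
    using assms unfolding order_converges_def by blast
  have dir: "\<exists>e\<in>y ` B. e \<le> c \<and> e \<le> d" if cd: "c \<in> y ` B" "d \<in> y ` B" for c d
  proof -
    obtain b b' where b: "b \<in> B" "b' \<in> B" "c = y b" "d = y b'" using cd by blast
    then obtain b'' where "b'' \<in> B" "s b b''" "s b' b''"
      using y unfolding decreases_to_zero_def directed_def by blast
    then show ?thesis
      using y b unfolding decreases_to_zero_def by blast
  qed
  have "down_to_zero (y ` B)"
    unfolding down_to_zero_def
    by (intro conjI ballI dir) (use y in \<open>auto simp: decreases_to_zero_def directed_def isGlb_iff\<close>)
  then show thesis using dom that by blast
qed

text \<open>
  The weak form of domination, in which only one term of the net is known to be close to the limit,
  is enough whenever the conclusion is an inequality for the limit.
\<close>
lemma order_converges_approx: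
  assumes "order_converges UNIV A r x l"
  obtains Y where "down_to_zero Y" "\<And>c. c \<in> Y \<Longrightarrow> \<exists>a\<in>A. \<bar>l - x a\<bar> \<le> c"
proof -
  have "r a a" if "a \<in> A" for a
    using assms that unfolding order_converges_def directed_def by (meson reflp_onD)
  then show thesis
    using order_convergesE[OF assms] that by metis
qed

lemma band_disjoint_complement: "band UNIV {z. z \<perp> y}"
  unfolding band_def ideal_def order_closed_def
proof (intro conjI ballI impI allI subset_UNIV)
  show "subspace {z. z \<perp> y}"
    unfolding subspace_def by (auto intro: disjoint_add disjoint_scaleR)
  show "x \<in> {z. z \<perp> y}" if "x' \<in> {z. z \<perp> y}" "\<bar>x\<bar> \<le> \<bar>x'\<bar>" for x x'
    using that by (auto intro: disjoint_mono)
  fix A :: "'a set" and r x l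
  assume conv: "order_converges UNIV A r x l \<and> x ` A \<subseteq> {z. z \<perp> y}"
  obtain Y where Y: "down_to_zero Y" "\<And>c. c \<in> Y \<Longrightarrow> \<exists>a\<in>A. \<bar>l - x a\<bar> \<le> c"
    using order_converges_approx[OF conjunct1[OF conv]] by metis
  have "inf (\<bar>l\<bar>) (\<bar>y\<bar>) \<le> c" if c: "c \<in> Y" for c
  proof -
    obtain a where a: "a \<in> A" "\<bar>l - x a\<bar> \<le> c" using Y(2)[OF c] by blast
    have "\<bar>l\<bar> \<le> \<bar>l - x a\<bar> + \<bar>x a\<bar>"
      using abs_triangle_ineq[of "l - x a" "x a"] by simp
    then have "inf (\<bar>l\<bar>) (\<bar>y\<bar>) \<le> inf (\<bar>l - x a\<bar> + \<bar>x a\<bar>) (\<bar>y\<bar>)"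
      by (intro inf_mono) simp_all
    also have "\<dots> \<le> inf (\<bar>l - x a\<bar>) (\<bar>y\<bar>) + inf (\<bar>x a\<bar>) (\<bar>y\<bar>)"
      by (intro inf_add_le) simp_all
    also have "inf (\<bar>x a\<bar>) (\<bar>y\<bar>) = 0"
      using conv a(1) by (auto simp: disjoint_def)
    also have "inf (\<bar>l - x a\<bar>) (\<bar>y\<bar>) + 0 \<le> c"
      using a(2) by (simp add: le_infI1)
    finally show ?thesis .
  qed
  then have "inf (\<bar>l\<bar>) (\<bar>y\<bar>) \<le> 0" by (rule down_to_zeroD(4)[OF Y(1)])
  moreover have "0 \<le> inf (\<bar>l\<bar>) (\<bar>y\<bar>)" by simp
  ultimately show "l \<in> {z. z \<perp> y}"
    unfolding disjoint_def by (simp only: mem_Collect_eq order_antisym)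
qed

text \<open>
  In a Dedekind complete vector lattice, every band contains the double disjoint complement of each
  of its elements \<open>x\<close>: the elements of the band in \<open>{0..\<bar>z\<bar>}\<close> have a supremum in the band, and what
  this leaves of \<open>\<bar>z\<bar>\<close> is disjoint from \<open>x\<close>.
\<close>
lemma band_double_complement:
  fixes x z :: "'a::dedekind_complete_vector_lattice"
  assumes B: "band UNIV B" and "x \<in> B" and z: "\<And>y. x \<perp> y \<Longrightarrow> z \<perp> y"
  shows "z \<in> B"
proof -
  have sub: "subspace B" and solid: "\<And>u v. v \<in> B \<Longrightarrow> \<bar>u\<bar> \<le> \<bar>v\<bar> \<Longrightarrow> u \<in> B"
    and closed: "order_closed UNIV B"
    using B unfolding band_def ideal_def by blast+
  define W where "W = {b \<in> B. 0 \<le> b \<and> b \<le> \<bar>z\<bar>}"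
  have W0: "0 \<in> W" using subspace_0[OF sub] by (simp add: W_def)
  have bdd: "bdd_above W" by (auto simp: W_def intro: bdd_aboveI)
  have "upward_directed W"
    unfolding upward_directed_def
  proof (intro conjI ballI)
    fix a b assume ab: "a \<in> W" "b \<in> W"
    have "\<bar>sup a b\<bar> \<le> \<bar>a + b\<bar>"
      using ab by (auto simp: W_def le_supI1 add_increasing add_increasing2)
    then have "sup a b \<in> B"
      using ab subspace_add[OF sub] by (intro solid[of "a + b" "sup a b"]) (auto simp: W_def)
    then have "sup a b \<in> W"
      using ab by (auto simp: W_def le_supI1)
    then show "\<exists>c\<in>W. a \<le> c \<and> b \<le> c" by (metis sup_ge1 sup_ge2)
  qed (use W0 in blast)
  then have sB: "Sup W \<in> B"
    using bdd by (intro order_closed_Sup[OF closed]) (auto simp: W_def)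
  have s0: "0 \<le> Sup W" by (intro cSup_upper W0 bdd)
  have sz: "Sup W \<le> \<bar>z\<bar>" using W0 by (intro cSup_least) (auto simp: W_def)
  let ?v = "inf (\<bar>z\<bar> - Sup W) (\<bar>x\<bar>)"
  have v0: "0 \<le> ?v" using sz by simp
  have vB: "?v \<in> B" using v0 by (intro solid[OF \<open>x \<in> B\<close>]) simp
  have "u \<le> Sup W - ?v" if u: "u \<in> W" for u
  proof -
    have "u + ?v \<le> Sup W + (\<bar>z\<bar> - Sup W)"
      using cSup_upper[OF u bdd] by (intro add_mono) simp_all
    then have "u + ?v \<in> W"
      using u v0 vB subspace_add[OF sub] by (auto simp: W_def)
    then show ?thesis
      using cSup_upper[OF _ bdd] by (simp only: le_diff_eq)
  qed
  then have "Sup W \<le> Sup W - ?v" using W0 by (intro cSup_least) auto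
  then have "?v \<le> 0" by (simp only: le_diff_eq add_le_same_cancel1)
  then have "x \<perp> \<bar>z\<bar> - Sup W"
    using v0 sz by (simp add: disjoint_def order_antisym inf_commute)
  then have "z \<perp> \<bar>z\<bar> - Sup W" by (rule z)
  then have "\<bar>z\<bar> - Sup W \<perp> \<bar>z\<bar> - Sup W"
    using s0 sz by (intro disjoint_mono[of z "\<bar>z\<bar> - Sup W" "\<bar>z\<bar> - Sup W" "\<bar>z\<bar> - Sup W"]) auto
  then have "\<bar>z\<bar> \<in> B"
    using sB disjoint_self by fastforce
  then show ?thesis by (rule solid) simp
qed

section \<open>Order bounded operators\<close>

lemma linear_ob_apply: "linear (ob_apply T)"
  using ob_apply[of T] by simp

lemma order_bounded_ob_apply: "order_bounded (ob_apply T)"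
  using ob_apply[of T] by simp

lemmas ob_apply_simps [simp] =
  zero_ob_op.rep_eq one_ob_op.rep_eq plus_ob_op.rep_eq uminus_ob_op.rep_eq minus_ob_op.rep_eq
  scaleR_ob_op.rep_eq times_ob_op.rep_eq
  linear_add[OF linear_ob_apply] linear_diff[OF linear_ob_apply] linear_neg[OF linear_ob_apply]
  linear_scale[OF linear_ob_apply] linear_0[OF linear_ob_apply]

lemma ob_apply_mono: "T \<le> U \<Longrightarrow> 0 \<le> x \<Longrightarrow> ob_apply T x \<le> ob_apply U x"
  by (simp add: less_eq_ob_op.rep_eq)

lemma ob_apply_nonneg: "0 \<le> T \<Longrightarrow> 0 \<le> x \<Longrightarrow> 0 \<le> ob_apply T x"
  using ob_apply_mono[of 0 T x] by simp

lemma ob_leI: "(\<And>x. 0 \<le> x \<Longrightarrow> ob_apply T x \<le> ob_apply U x) \<Longrightarrow> T \<le> U"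
  by (simp add: less_eq_ob_op.rep_eq)

lemma zero_le_one_ob_op: "(0::'a::dedekind_complete_vector_lattice ob_op) \<le> 1"
  by (rule ob_leI) simp

lemma ob_apply_mono_arg: "0 \<le> T \<Longrightarrow> x \<le> y \<Longrightarrow> ob_apply T x \<le> ob_apply T y"
  using ob_apply_nonneg[of T "y - x"] by simp

lemma ob_eqI: "(\<And>x. 0 \<le> x \<Longrightarrow> ob_apply T x = ob_apply U x) \<Longrightarrow> T = U"
  by (intro order_antisym ob_leI) simp_all

lemma ob_apply_abs_le: "\<bar>ob_apply T x\<bar> \<le> ob_apply (\<bar>T\<bar>) (\<bar>x\<bar>)"
proof -
  have *: "\<bar>ob_apply T x\<bar> \<le> ob_apply (\<bar>T\<bar>) x" if "0 \<le> x" for x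
    using ob_apply_mono[of T "\<bar>T\<bar>" x] ob_apply_mono[of "- T" "\<bar>T\<bar>" x] that
    by (intro abs_leI) (simp_all add: abs_ge_self abs_ge_minus_self)
  have "\<bar>ob_apply T x\<bar> = \<bar>ob_apply T (pprt x) - ob_apply T (- nprt x)\<bar>"
    using arg_cong[OF prts[of x], of "ob_apply T"] by simp
  also have "\<dots> \<le> \<bar>ob_apply T (pprt x)\<bar> + \<bar>ob_apply T (- nprt x)\<bar>"
    by (rule abs_triangle_ineq4)
  also have "\<dots> \<le> ob_apply (\<bar>T\<bar>) (pprt x) + ob_apply (\<bar>T\<bar>) (- nprt x)"
    using *[of "pprt x"] *[of "- nprt x"] by (intro add_mono) simp_all
  also have "\<dots> = ob_apply (\<bar>T\<bar>) (\<bar>x\<bar>)"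
    by (simp add: abs_prts)
  finally show ?thesis .
qed

instance ob_op :: (dedekind_complete_vector_lattice) lattice_ring
proof
  fix A B C :: "'a ob_op"
  assume "A \<le> B" "0 \<le> C"
  then show "C * A \<le> C * B"
    by (intro ob_leI) (simp add: ob_apply_mono_arg ob_apply_mono)
  show "A * C \<le> B * C"
    using \<open>A \<le> B\<close> \<open>0 \<le> C\<close> by (intro ob_leI) (simp add: ob_apply_mono ob_apply_nonneg)
qed

lemma ob_pos_part_eq_pprt: "ob_pos_part T = pprt T"
  by (simp add: pprt_def sup_ob_op_def)

lemma pprt_apply_least:
  assumes "0 \<le> x" "\<And>z. 0 \<le> z \<Longrightarrow> z \<le> x \<Longrightarrow> ob_apply T z \<le> u"
  shows "ob_apply (pprt T) x \<le> u"
  using assms by (simp add: ob_pos_part_apply flip: ob_pos_part_eq_pprt) (rule rk_least)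

section \<open>Dedekind completeness of the space of operators\<close>
lemma positive_linear_order_bounded:
  assumes "linear f" "\<And>x. 0 \<le> x \<Longrightarrow> 0 \<le> f x"
  shows "order_bounded f"
proof -
  have "f x \<le> f y" if "x \<le> y" for x y
    using assms(2)[of "y - x"] that by (simp add: linear_diff[OF assms(1)])
  then have "f ` {a..b} \<subseteq> {f a..f b}" for a b by auto
  then show ?thesis unfolding order_bounded_def by blast
qed

lemma additive_diff_prts:
  fixes f :: "'a::dedekind_complete_vector_lattice \<Rightarrow> 'a"
  assumes add: "\<And>x y. 0 \<le> x \<Longrightarrow> 0 \<le> y \<Longrightarrow> f (x + y) = f x + f y" and uv: "0 \<le> u" "0 \<le> v"
  shows "f (pprt (u - v)) - f (- nprt (u - v)) = f u - f v"
proof -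
  have "pprt (u - v) + v = u + - nprt (u - v)"
    using prts[of "u - v"] by (simp add: algebra_simps)
  then have "f (pprt (u - v)) + f v = f u + f (- nprt (u - v))"
    using uv by (metis add zero_le_pprt nprt_le_zero neg_0_le_iff_le)
  then show ?thesis by (simp add: algebra_simps)
qed

text \<open>
  A positive function that is additive and positively homogeneous on the positive cone is the
  restriction of a positive operator, by writing elements as differences of positive ones.
\<close>
lemma Kantorovich_extension:
  fixes f :: "'a::dedekind_complete_vector_lattice \<Rightarrow> 'a"
  assumes add: "\<And>x y. 0 \<le> x \<Longrightarrow> 0 \<le> y \<Longrightarrow> f (x + y) = f x + f y"
    and scale: "\<And>k x. 0 < k \<Longrightarrow> 0 \<le> x \<Longrightarrow> f (k *\<^sub>R x) = k *\<^sub>R f x"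
    and nonneg: "\<And>x. 0 \<le> x \<Longrightarrow> 0 \<le> f x"
  obtains U where "\<And>x. 0 \<le> x \<Longrightarrow> ob_apply U x = f x"
proof -
  define g where "g x = f (pprt x) - f (- nprt x)" for x
  have f0: "f 0 = 0" using add[of 0 0] by simp
  have g_diff: "g (u - v) = f u - f v" if "0 \<le> u" "0 \<le> v" for u v
    unfolding g_def using additive_diff_prts[of f u v] add that by blast
  have pn: "x = pprt x - (- nprt x)" "0 \<le> pprt x" "0 \<le> - nprt x" for x :: 'a
    using prts[of x] by auto
  have gadd: "g (x + y) = g x + g y" for x y
  proof -
    have "x + y = (pprt x + pprt y) - (- nprt x + - nprt y)"
      using arg_cong2[OF prts[of x] prts[of y], of "(+)"] by (simp add: ac_simps)
    then have "g (x + y) = f (pprt x + pprt y) - f (- nprt x + - nprt y)"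
      using g_diff[of "pprt x + pprt y" "- nprt x + - nprt y"] pn by (metis add_nonneg_nonneg)
    then show ?thesis
      using add[OF pn(2) pn(2)] add[OF pn(3) pn(3)] by (simp add: g_def algebra_simps)
  qed
  have gneg: "g (- x) = - g x" for x
    by (simp add: g_def pprt_neg nprt_neg)
  have gpos: "g (k *\<^sub>R x) = k *\<^sub>R g x" if k: "0 < k" for k x
  proof -
    have "g (k *\<^sub>R pprt x - k *\<^sub>R (- nprt x)) = f (k *\<^sub>R pprt x) - f (k *\<^sub>R (- nprt x))"
      using k pn by (intro g_diff scaleR_nonneg_nonneg) auto
    also have "\<dots> = k *\<^sub>R (f (pprt x) - f (- nprt x))"
      using k pn by (simp only: scale scaleR_diff_right)
    finally show ?thesis
      unfolding g_def[of x] scaleR_diff_right[symmetric] pprt_minus_nprt .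
  qed
  have lin: "linear g"
  proof (rule linearI)
    fix k :: real and x
    consider "k > 0" | "k = 0" | "- k > 0" by linarith
    then show "g (k *\<^sub>R x) = k *\<^sub>R g x"
    proof cases
      case 2
      then show ?thesis by (simp add: g_def)
    next
      case 3
      have "g (- (k *\<^sub>R x)) = - (k *\<^sub>R g x)"
        using gpos[OF 3, of x] by simp
      then show ?thesis
        unfolding gneg by (rule neg_equal_iff_equal[THEN iffD1])
    qed (rule gpos)
  qed (rule gadd)
  have gf: "g x = f x" if "0 \<le> x" for x using that f0 by (simp add: g_def)
  have "order_bounded g"
    using nonneg gf by (intro positive_linear_order_bounded lin) simp
  then have "ob_apply (Ob_op g) = g" using lin by (simp add: Ob_op_inverse)
  then show thesis using gf that by metis
qed

text \<open>
  For upward directed sets of operators the pointwise supremum on the positive cone is additive,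
  because two operators from the set, one for each summand, can be replaced by a common upper bound.
  Suprema of arbitrary bounded sets need not be pointwise; they are reduced to directed ones by
  adjoining suprema of finite subsets.
\<close>
lemma directed_Sup_apply:
  fixes D :: "'a::dedekind_complete_vector_lattice ob_op set"
  assumes D: "upward_directed D" and M: "\<And>d. d \<in> D \<Longrightarrow> d \<le> M"
  obtains U where "\<And>x. 0 \<le> x \<Longrightarrow> ob_apply U x = Sup ((\<lambda>d. ob_apply d x) ` D)"
proof -
  obtain d0 where d0: "d0 \<in> D" using D unfolding upward_directed_def by blast
  define S where "S x = Sup ((\<lambda>d. ob_apply d x) ` D)" for x
  have bdd: "bdd_above ((\<lambda>d. ob_apply d x) ` D)" if "0 \<le> x" for x
    using M that by (intro bdd_aboveI[of _ "ob_apply M x"]) (auto intro: ob_apply_mono)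
  have upper: "ob_apply d x \<le> S x" if "d \<in> D" "0 \<le> x" for d x
    unfolding S_def using that bdd by (intro cSup_upper) auto
  have least: "S x \<le> u" if "\<And>d. d \<in> D \<Longrightarrow> ob_apply d x \<le> u" for x u
    unfolding S_def using that d0 by (intro cSup_least) auto
  have add: "S (x + y) = S x + S y" if xy: "0 \<le> x" "0 \<le> y" for x y
  proof (rule order_antisym)
    show "S (x + y) \<le> S x + S y"
      using upper xy by (intro least) (auto intro: add_mono)
    have "S y \<le> S (x + y) - S x"
    proof (rule least)
      fix e assume e: "e \<in> D"
      have "S x \<le> S (x + y) - ob_apply e y"
      proof (rule least)
        fix d assume "d \<in> D"
        then obtain c where c: "c \<in> D" "d \<le> c" "e \<le> c"
          using D e unfolding upward_directed_def by blast
        have "ob_apply d x + ob_apply e y \<le> ob_apply c (x + y)"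
          using c xy by (auto intro!: add_mono ob_apply_mono)
        also have "\<dots> \<le> S (x + y)" using c xy by (intro upper) auto
        finally show "ob_apply d x \<le> S (x + y) - ob_apply e y" by (simp add: algebra_simps)
      qed
      then show "ob_apply e y \<le> S (x + y) - S x" by (simp add: algebra_simps)
    qed
    then show "S x + S y \<le> S (x + y)" by (simp add: algebra_simps)
  qed
  have le: "S (k *\<^sub>R x) \<le> k *\<^sub>R S x" if "0 < k" "0 \<le> x" for k x
    using that upper by (intro least) (auto intro: scaleR_left_mono)
  have scale: "S (k *\<^sub>R x) = k *\<^sub>R S x" if k: "0 < k" and x: "0 \<le> x" for k x
  proof (rule order_antisym[OF le[OF k x]])
    have "S (inverse k *\<^sub>R k *\<^sub>R x) \<le> inverse k *\<^sub>R S (k *\<^sub>R x)"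
      using k x by (intro le scaleR_nonneg_nonneg) auto
    then have "k *\<^sub>R S x \<le> k *\<^sub>R inverse k *\<^sub>R S (k *\<^sub>R x)"
      using k by (intro scaleR_left_mono) auto
    then show "k *\<^sub>R S x \<le> S (k *\<^sub>R x)" using k by simp
  qed
  \<comment> \<open>Subtracting a member of the set makes the pointwise supremum positive.\<close>
  obtain U where U: "\<And>x. 0 \<le> x \<Longrightarrow> ob_apply U x = S x - ob_apply d0 x"
  proof (rule Kantorovich_extension[of "\<lambda>x. S x - ob_apply d0 x"])
    show "0 \<le> S x - ob_apply d0 x" if "0 \<le> x" for x
      using upper[OF d0 that] by simp
  qed (auto simp: add scale algebra_simps)
  have "ob_apply (U + d0) x = S x" if "0 \<le> x" for x
    using U[OF that] by simp
  then show thesis using that unfolding S_def by blast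
qed

inductive_set sup_closure :: "'g::lattice set \<Rightarrow> 'g set" for X where
  base: "x \<in> X \<Longrightarrow> x \<in> sup_closure X"
| sup: "x \<in> sup_closure X \<Longrightarrow> y \<in> sup_closure X \<Longrightarrow> sup x y \<in> sup_closure X"

lemma sup_closure_le:
  assumes "d \<in> sup_closure X" "\<And>x. x \<in> X \<Longrightarrow> x \<le> u"
  shows "d \<le> u"
  using assms by induction auto

lemma upward_directed_sup_closure:
  assumes "X \<noteq> {}"
  shows "upward_directed (sup_closure X)"
proof -
  have "sup_closure X \<noteq> {}" using assms sup_closure.base by blast
  moreover have "\<exists>c\<in>sup_closure X. a \<le> c \<and> b \<le> c"
    if "a \<in> sup_closure X" "b \<in> sup_closure X" for a b
    using sup_closure.sup[OF that] by (metis sup_ge1 sup_ge2)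
  ultimately show ?thesis unfolding upward_directed_def by blast
qed

lemma ob_op_lub:
  fixes X :: "'a::dedekind_complete_vector_lattice ob_op set"
  assumes "X \<noteq> {}" "bdd_above X"
  shows "\<exists>s. isLub UNIV X s"
proof -
  obtain M where M: "\<And>x. x \<in> X \<Longrightarrow> x \<le> M"
    using assms(2) unfolding bdd_above_def by blast
  let ?D = "sup_closure X"
  have D: "upward_directed ?D" using assms(1) by (rule upward_directed_sup_closure)
  have DM: "d \<le> u" if "d \<in> ?D" "\<And>x. x \<in> X \<Longrightarrow> x \<le> u" for d u
    using that by (rule sup_closure_le)
  obtain U where U: "\<And>x. 0 \<le> x \<Longrightarrow> ob_apply U x = Sup ((\<lambda>d. ob_apply d x) ` ?D)"
    using directed_Sup_apply[OF D DM[OF _ M]] by blast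
  have "T \<le> U" if "T \<in> X" for T
  proof (rule ob_leI)
    fix x :: 'a assume x: "0 \<le> x"
    have "bdd_above ((\<lambda>d. ob_apply d x) ` ?D)"
      using DM[OF _ M] x by (intro bdd_aboveI[of _ "ob_apply M x"]) (auto intro: ob_apply_mono)
    then show "ob_apply T x \<le> ob_apply U x"
      unfolding U[OF x] using that by (intro cSup_upper) (auto intro: sup_closure.base)
  qed
  moreover have "U \<le> V" if V: "\<And>T. T \<in> X \<Longrightarrow> T \<le> V" for V
  proof (rule ob_leI)
    fix x :: 'a assume x: "0 \<le> x"
    show "ob_apply U x \<le> ob_apply V x"
      unfolding U[OF x] using D DM[OF _ V] x
      by (intro cSup_least) (auto simp: upward_directed_def intro: ob_apply_mono)
  qed
  ultimately show ?thesis unfolding isLub_iff by blast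
qed

text \<open>
  The operators again form a Dedekind complete vector lattice. Consequently \<^typ>\<open>'a ob_op ob_op\<close> makes
  sense, and the results on orthomorphisms apply to the multiplication operators on \<^typ>\<open>'a ob_op\<close>.
\<close>
instantiation ob_op :: (dedekind_complete_vector_lattice) dedekind_complete_vector_lattice
begin

definition Sup_ob_op :: "'a ob_op set \<Rightarrow> 'a ob_op" where
  "Sup_ob_op X = (SOME s. isLub UNIV X s)"

definition Inf_ob_op :: "'a ob_op set \<Rightarrow> 'a ob_op" where
  "Inf_ob_op X = - Sup (uminus ` X)"

instance
proof
  have lub: "isLub UNIV X (Sup X)" if "X \<noteq> {}" "bdd_above X" for X :: "'a ob_op set"
    unfolding Sup_ob_op_def using ob_op_lub[OF that] by (rule someI_ex)
  fix x z :: "'a ob_op" and X :: "'a ob_op set"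
  show "x \<le> Sup X" if "x \<in> X" "bdd_above X"
    using lub[of X] that by (auto simp: isLub_iff)
  show "Sup X \<le> z" if "X \<noteq> {}" "\<And>x. x \<in> X \<Longrightarrow> x \<le> z"
    using lub[OF that(1) bdd_aboveI[OF that(2)]] that by (simp add: isLub_iff)
  show "Inf X \<le> x" if xX: "x \<in> X" and bdd: "bdd_below X"
  proof -
    obtain m where "\<And>y. y \<in> X \<Longrightarrow> m \<le> y"
      using bdd unfolding bdd_below_def by blast
    then have "bdd_above (uminus ` X)" by (intro bdd_aboveI[of _ "- m"]) auto
    then have "- x \<le> Sup (uminus ` X)"
      using lub[of "uminus ` X"] xX by (auto simp: isLub_iff)
    then show ?thesis unfolding Inf_ob_op_def by (rule minus_le_iff[THEN iffD1])
  qed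
  show "z \<le> Inf X" if "X \<noteq> {}" "\<And>x. x \<in> X \<Longrightarrow> z \<le> x"
  proof -
    have "bdd_above (uminus ` X)" using that by (intro bdd_aboveI[of _ "- z"]) auto
    then have "Sup (uminus ` X) \<le> - z"
      using lub[of "uminus ` X"] that by (auto simp: isLub_iff)
    then show ?thesis unfolding Inf_ob_op_def by (rule le_minus_iff[THEN iffD1])
  qed
qed

end

text \<open>
  By directedness the pointwise infimum on the positive cone is the restriction of an operator; this
  operator is a lower bound of the set, hence at most \<open>0\<close>.
\<close>
lemma directed_Inf_zero_apply:
  fixes Y :: "'a::dedekind_complete_vector_lattice ob_op set"
  assumes Y: "down_to_zero Y" and x: "0 \<le> x" and u: "\<And>c. c \<in> Y \<Longrightarrow> u \<le> ob_apply c x"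
  shows "u \<le> 0"
proof -
  note Y = down_to_zeroD[OF Y]
  let ?D = "uminus ` Y"
  have D: "upward_directed ?D"
    unfolding upward_directed_def using Y(1,3) by force
  have D0: "d \<le> 0" if "d \<in> ?D" for d
    using that Y(2) by auto
  obtain U where U: "\<And>x. 0 \<le> x \<Longrightarrow> ob_apply U x = Sup ((\<lambda>d. ob_apply d x) ` ?D)"
    using directed_Sup_apply[OF D D0] by blast
  have "- U \<le> c" if c: "c \<in> Y" for c
  proof (rule ob_leI)
    fix x :: 'a assume x: "0 \<le> x"
    have "bdd_above ((\<lambda>d. ob_apply d x) ` ?D)"
      using ob_apply_nonneg[OF Y(2)] x by (intro bdd_aboveI[of _ 0]) auto
    then have "ob_apply (- c) x \<le> ob_apply U x"
      unfolding U[OF x] using c by (intro cSup_upper imageI)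
    then show "ob_apply (- U) x \<le> ob_apply c x"
      by (simp add: minus_le_iff)
  qed
  then have "- U \<le> 0" by (rule Y(4))
  then have "0 \<le> ob_apply U x"
    using ob_apply_nonneg[of U x] x by simp
  also have "ob_apply U x \<le> - u"
    unfolding U[OF x] using Y(1) u by (intro cSup_least) auto
  finally show ?thesis by simp
qed

section \<open>Orthomorphisms\<close>

text \<open>
  Preservation of bands is preservation of disjointness with a fixed element, since the disjoint
  complements of single elements are bands and every band contains the double disjoint complements
  of its elements.
\<close>
lemma Orth_iff: "T \<in> Orth \<longleftrightarrow> (\<forall>x y. x \<perp> y \<longrightarrow> ob_apply T x \<perp> y)"
proof
  assume "T \<in> Orth"
  then show "\<forall>x y. x \<perp> y \<longrightarrow> ob_apply T x \<perp> y"
    using band_disjoint_complement unfolding Orth_def by blast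
next
  assume T: "\<forall>x y. x \<perp> y \<longrightarrow> ob_apply T x \<perp> y"
  have "ob_apply T x \<in> B" if "band UNIV B" "x \<in> B" for B x
    using band_double_complement[OF that] T by blast
  then show "T \<in> Orth" unfolding Orth_def by blast
qed

lemma OrthD: "T \<in> Orth \<Longrightarrow> x \<perp> y \<Longrightarrow> ob_apply T x \<perp> y"
  by (simp add: Orth_iff)

lemma OrthI_nonneg:
  fixes T :: "'a::dedekind_complete_vector_lattice ob_op"
  assumes "\<And>x y. 0 \<le> x \<Longrightarrow> 0 \<le> y \<Longrightarrow> x \<perp> y \<Longrightarrow> ob_apply T x \<perp> y"
  shows "T \<in> Orth"
  unfolding Orth_iff
proof (intro allI impI)
  fix x y :: 'a assume xy: "x \<perp> y"
  have "ob_apply T (pprt x) \<perp> \<bar>y\<bar>" "ob_apply T (- nprt x) \<perp> \<bar>y\<bar>"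
    using xy disjoint_prts_iff[of x y] by (intro assms; simp)+
  then have "ob_apply T (pprt x) - ob_apply T (- nprt x) \<perp> y"
    by (intro disjoint_diff) simp_all
  also have "ob_apply T (pprt x) - ob_apply T (- nprt x) = ob_apply T x"
    using arg_cong[OF pprt_minus_nprt[of x], of "ob_apply T"] by simp
  finally show "ob_apply T x \<perp> y" .
qed

lemma subspace_Orth: "subspace Orth"
  by (auto simp: subspace_def Orth_iff intro: disjoint_add disjoint_scaleR)

lemma one_in_Orth: "1 \<in> Orth"
  by (simp add: Orth_iff)

lemma Orth_mult: "T \<in> Orth \<Longrightarrow> U \<in> Orth \<Longrightarrow> T * U \<in> Orth"
  by (simp add: Orth_iff)

lemma Orth_pprt:
  assumes T: "T \<in> Orth"
  shows "pprt T \<in> Orth"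
proof (rule OrthI_nonneg)
  fix x y :: 'a assume xy: "0 \<le> x" "0 \<le> y" "x \<perp> y"
  obtain c d where "ob_apply T ` {0..x} \<subseteq> {c..d}"
    using order_bounded_ob_apply[of T] unfolding order_bounded_def by blast
  then have bdd: "bdd_above (ob_apply T ` {0..x})"
    by (meson bdd_above_Icc bdd_above_mono)
  have "v \<perp> y" if "v \<in> ob_apply T ` {0..x}" for v
  proof -
    obtain z where z: "0 \<le> z" "z \<le> x" "v = ob_apply T z" using \<open>v \<in> _\<close> by auto
    then have "z \<perp> y" using xy by (intro disjoint_mono[of x y z y]) auto
    then show ?thesis unfolding z(3) by (rule OrthD[OF T])
  qed
  then have "rk (ob_apply T) x \<perp> y"
    unfolding rk_def using bdd xy(1) by (intro disjoint_Sup) auto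
  then show "ob_apply (pprt T) x \<perp> y"
    by (simp add: ob_pos_part_apply xy flip: ob_pos_part_eq_pprt)
qed

lemma Orth_uminus: "T \<in> Orth \<Longrightarrow> - T \<in> Orth"
  using subspace_neg[OF subspace_Orth] .

lemma Orth_nprt: "T \<in> Orth \<Longrightarrow> nprt T \<in> Orth"
  using Orth_uminus[OF Orth_pprt[OF Orth_uminus]] by (simp add: pprt_neg)

lemma Orth_abs: "T \<in> Orth \<Longrightarrow> \<bar>T\<bar> \<in> Orth"
  unfolding abs_prts by (intro subspace_diff[OF subspace_Orth] Orth_pprt Orth_nprt)

text \<open>
  Along the band of \<open>pprt (x - y)\<close> one has \<open>y \<le> x\<close>, and \<open>x \<le> y\<close> on its complement; so the component
  of \<open>x + y\<close> in the band is at most \<open>2x\<close> and the other one at most \<open>2y\<close>.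
\<close>
lemma disjoint_split_of_sum:
  assumes "0 \<le> x" "0 \<le> y"
  obtains x1 x2 where "x + y = x1 + x2" "0 \<le> x1" "0 \<le> x2" "x1 \<perp> x2"
    "x1 \<le> y + y" "x2 \<le> x + (x::'a::dedekind_complete_vector_lattice)"
proof -
  define w where "w = pprt (x - y)"
  obtain a1 a2 where a: "x = a1 + a2" "0 \<le> a1" "0 \<le> a2" "a1 \<perp> w" "\<And>c. c \<perp> w \<Longrightarrow> a2 \<perp> c"
    using disjoint_band_decomposition[OF assms(1)] by metis
  obtain b1 b2 where b: "y = b1 + b2" "0 \<le> b1" "0 \<le> b2" "b1 \<perp> w" "\<And>c. c \<perp> w \<Longrightarrow> b2 \<perp> c"
    using disjoint_band_decomposition[OF assms(2)] by metis
  have w: "w = pprt ((a1 - b1) + (a2 - b2))"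
    unfolding w_def a(1) b(1) by (simp add: algebra_simps)
  have "a1 - b1 \<le> 0" "0 \<le> a2 - b2"
    by (rule split_signs[of "a1 - b1" "a2 - b2"]; unfold w[symmetric];
        blast intro: disjoint_diff a(4,5) b(4,5))+
  then have le: "a1 \<le> b1" "b2 \<le> a2" by simp_all
  have "a1 + b1 \<perp> a2 + b2"
    using a b by (meson disjoint_add disjoint_sym)
  moreover have "a1 + b1 \<le> y + y" "a2 + b2 \<le> x + x"
    unfolding a(1) b(1) using le a b
    by (auto intro!: add_mono simp: add_increasing add_increasing2)
  ultimately show thesis
    using a b by (intro that[of "a1 + b1" "a2 + b2"]) (auto simp: algebra_simps)
qed

text \<open>
  Disjoint positive orthomorphisms have disjoint values. By the Riesz-Kantorovich formula
  \<open>inf A B = 0\<close> says that the infimum of \<open>A y + B (x - y)\<close> over \<open>y\<close> in \<open>{0..x}\<close> is \<open>0\<close>. Up to a factor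
  \<open>2\<close> it suffices to let \<open>y\<close> run over components of \<open>x\<close>, and for these the sum dominates
  \<open>inf (A x) (B x)\<close>, because \<open>A\<close> and \<open>B\<close> preserve the disjointness of \<open>y\<close> and \<open>x - y\<close>.
\<close>
lemma Orth_disjoint_apply_same:
  assumes A: "A \<in> Orth" "0 \<le> A" and B: "B \<in> Orth" "0 \<le> B" and AB: "inf A B = 0" and x: "0 \<le> x"
  shows "inf (ob_apply A x) (ob_apply B x) = 0"
proof -
  let ?A = "ob_apply A" and ?B = "ob_apply B"
  let ?m = "inf (?A x) (?B x)"
  have bound: "?A y - ?B y \<le> ?A x - (1/2) *\<^sub>R ?m" if y: "0 \<le> y" "y \<le> x" for y
  proof -
    let ?z = "x - y"
    obtain x1 x2 where d: "y + ?z = x1 + x2" "0 \<le> x1" "0 \<le> x2" "x1 \<perp> x2"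
      "x1 \<le> ?z + ?z" "x2 \<le> y + y"
      using disjoint_split_of_sum[of y ?z] y by auto
    have xd: "x = x1 + x2" using d(1) by simp
    have "?B x1 \<perp> ?A x2"
      using OrthD[OF B(1)] OrthD[OF A(1)] d(4) by (meson disjoint_sym)
    then have disj: "inf (?B x1) (?A x2) = 0"
      using ob_apply_nonneg[OF A(2) d(3)] ob_apply_nonneg[OF B(2) d(2)]
      by (simp add: disjoint_nonneg_iff)
    have "?m \<le> ?A x1 + ?A x2" "?m \<le> ?B x1 + ?B x2"
      unfolding xd by simp_all
    moreover have "?A x1 + ?A x2 \<le> ?A x2 + (?A x1 + ?B x2)"
      "?B x1 + ?B x2 \<le> ?B x1 + (?A x1 + ?B x2)"
      using ob_apply_nonneg[OF A(2) d(2)] ob_apply_nonneg[OF B(2) d(3)] by simp_all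
    ultimately have "?m - (?A x1 + ?B x2) \<le> ?A x2" "?m - (?A x1 + ?B x2) \<le> ?B x1"
      unfolding diff_le_eq by (meson order_trans)+
    then have "?m - (?A x1 + ?B x2) \<le> 0"
      using disj by (metis inf_greatest)
    then have "?m \<le> ?A x1 + ?B x2" by (simp only: diff_le_0_iff_le)
    also have "\<dots> \<le> ?A (?z + ?z) + ?B (y + y)"
      using d by (intro add_mono ob_apply_mono_arg A B)
    also have "\<dots> = 2 *\<^sub>R (?A ?z + ?B y)"
      by (simp add: scaleR_2 algebra_simps)
    finally have "(1/2) *\<^sub>R ?m \<le> (1/2) *\<^sub>R 2 *\<^sub>R (?A ?z + ?B y)"
      by (intro scaleR_left_mono) auto
    then show ?thesis by (simp add: algebra_simps)
  qed
  have "?A x = ob_apply (pprt (A - B)) x"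
    by (simp only: pprt_diff_disjoint[OF AB])
  also have "\<dots> \<le> ?A x - (1/2) *\<^sub>R ?m"
    using x bound by (intro pprt_apply_least) (simp_all only: minus_ob_op.rep_eq)
  finally have "(1/2) *\<^sub>R ?m \<le> 0"
    by (simp only: le_diff_eq add_le_same_cancel1)
  then have "2 *\<^sub>R (1/2) *\<^sub>R ?m \<le> 2 *\<^sub>R 0"
    by (intro scaleR_left_mono) auto
  then show ?thesis
    using ob_apply_nonneg[OF A(2) x] ob_apply_nonneg[OF B(2) x]
    by (intro order_antisym) auto
qed

lemma Orth_disjoint_apply:
  assumes A: "A \<in> Orth" "0 \<le> A" and B: "B \<in> Orth" "0 \<le> B" and AB: "inf A B = 0"
    and x: "0 \<le> x" and y: "0 \<le> y"
  shows "inf (ob_apply A x) (ob_apply B y) = 0"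
proof (rule order_antisym)
  have "inf (ob_apply A x) (ob_apply B y) \<le> inf (ob_apply A (sup x y)) (ob_apply B (sup x y))"
    by (intro inf_mono ob_apply_mono_arg A B) auto
  also have "\<dots> = 0" by (intro Orth_disjoint_apply_same A B AB le_supI1 x)
  finally show "inf (ob_apply A x) (ob_apply B y) \<le> 0" .
qed (use ob_apply_nonneg[OF A(2) x] ob_apply_nonneg[OF B(2) y] in simp)

text \<open>
  Positive orthomorphisms are order continuous. For \<open>e > 0\<close> the part of \<open>x\<close> above \<open>e x0\<close> contributes
  to \<open>T x\<close> only something disjoint from \<open>pprt (e x0 - x)\<close>. As \<open>X\<close> has infimum \<open>0\<close>, the latter have
  supremum \<open>e x0\<close>; so what remains of \<open>u\<close> above \<open>e T x0\<close> is disjoint from \<open>x0\<close>, and being at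
  most \<open>T x0\<close> it vanishes.
\<close>
lemma Orth_order_continuous:
  assumes T: "T \<in> Orth" "0 \<le> T" and X: "X \<noteq> {}" "\<And>x. x \<in> X \<Longrightarrow> 0 \<le> x"
    and inf0: "\<And>u. (\<And>x. x \<in> X \<Longrightarrow> u \<le> x) \<Longrightarrow> u \<le> 0"
    and u: "\<And>x. x \<in> X \<Longrightarrow> u \<le> ob_apply T x"
  shows "u \<le> 0"
proof -
  obtain x0 where x0: "x0 \<in> X" using X(1) by blast
  have x0': "0 \<le> x0" using X(2) x0 .
  have "real n *\<^sub>R u \<le> ob_apply T x0" if n: "0 < n" for n
  proof -
    define e where "e = inverse (real n)"
    have e: "0 < e" using n by (simp add: e_def)
    define v where "v = pprt (u - e *\<^sub>R ob_apply T x0)"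
    have v_le: "v \<le> ob_apply T (pprt (x - e *\<^sub>R x0))" if x: "x \<in> X" for x
    proof -
      have "u \<le> ob_apply T (e *\<^sub>R x0 + pprt (x - e *\<^sub>R x0))"
        using u[OF x] ob_apply_mono_arg[OF T(2), of x "e *\<^sub>R x0 + pprt (x - e *\<^sub>R x0)"]
          le_pprt[of "x - e *\<^sub>R x0"] by (simp add: algebra_simps)
      then have "u - e *\<^sub>R ob_apply T x0 \<le> ob_apply T (pprt (x - e *\<^sub>R x0))"
        by (simp add: algebra_simps)
      then show ?thesis
        unfolding v_def using ob_apply_nonneg[OF T(2)] by (intro pprt_least) auto
    qed
    have v0: "0 \<le> v" by (simp add: v_def)
    let ?g = "inf v (e *\<^sub>R x0)"
    have ex0: "0 \<le> e *\<^sub>R x0" using e x0' by (simp add: scaleR_nonneg_nonneg)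
    have "?g \<le> x" if x: "x \<in> X" for x
    proof -
      let ?p = "pprt (e *\<^sub>R x0 - x)"
      have "ob_apply T (pprt (x - e *\<^sub>R x0)) \<perp> nprt (x - e *\<^sub>R x0)"
        by (intro OrthD[OF T(1)] disjoint_pprt_nprt)
      moreover have "nprt (x - e *\<^sub>R x0) = - ?p"
        using nprt_neg[of "e *\<^sub>R x0 - x"] by simp
      ultimately have "ob_apply T (pprt (x - e *\<^sub>R x0)) \<perp> ?p" by simp
      then have "?g \<perp> ?p"
        by (rule disjoint_mono)
          (use v0 ex0 v_le[OF x] ob_apply_nonneg[OF T(2), of "pprt (x - e *\<^sub>R x0)"] in
            \<open>auto intro: le_infI1\<close>)
      then have "inf ?g ?p = 0" using v0 ex0 by (simp add: disjoint_nonneg_iff)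
      then have "?g + ?p = sup ?g ?p" by (rule disjoint_add_eq_sup)
      also have "\<dots> \<le> e *\<^sub>R x0"
        using X(2)[OF x] ex0 by (intro sup_least pprt_least) auto
      finally have "?g + (e *\<^sub>R x0 - x) \<le> e *\<^sub>R x0"
        using le_pprt[of "e *\<^sub>R x0 - x"] by (meson add_left_mono order_trans)
      then show ?thesis by (simp add: algebra_simps)
    qed
    then have "?g \<le> 0" by (rule inf0)
    then have "e *\<^sub>R x0 \<perp> v"
      using v0 ex0 by (simp add: disjoint_nonneg_iff inf_commute order_antisym)
    then have "inverse e *\<^sub>R e *\<^sub>R x0 \<perp> v" by (rule disjoint_scaleR)
    then have "x0 \<perp> v" using e by simp
    then have "ob_apply T x0 \<perp> v" by (rule OrthD[OF T(1)])
    moreover have "v \<le> ob_apply T x0"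
    proof -
      have "pprt (x0 - e *\<^sub>R x0) \<le> x0"
        using ex0 x0' by (intro pprt_least) auto
      then show ?thesis
        using v_le[OF x0] ob_apply_mono_arg[OF T(2)] order_trans by blast
    qed
    ultimately have "v \<perp> v" using v0 by (intro disjoint_mono[of "ob_apply T x0" v v v]) auto
    then have "u - e *\<^sub>R ob_apply T x0 \<le> 0"
      using disjoint_self[of v] le_pprt[of "u - e *\<^sub>R ob_apply T x0"] by (simp add: v_def)
    then have "real n *\<^sub>R u \<le> real n *\<^sub>R e *\<^sub>R ob_apply T x0"
      by (intro scaleR_left_mono) auto
    then show ?thesis using n by (simp add: e_def)
  qed
  then show ?thesis by (rule Archimedean_le_zero)
qed

text \<open>
  The kernel of an orthomorphism \<open>D\<close> is also the kernel of \<open>\<lambda>x. \<bar>D\<bar> \<bar>x\<bar>\<close>: the images of \<open>pprt x\<close> and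
  \<open>nprt x\<close> under \<open>D\<close> are disjoint, and so are the values of \<open>pprt D\<close> and \<open>nprt D\<close> at a positive
  element, so that no cancellation is possible. Hence it is an ideal, and order continuity of \<open>\<bar>D\<bar>\<close>
  makes it a band.
\<close>
lemma band_Orth_kernel:
  assumes D: "D \<in> Orth"
  shows "band UNIV {x. ob_apply D x = 0}"
proof -
  let ?P = "pprt D" and ?N = "- nprt D"
  have absD: "\<bar>D\<bar> = ?P + ?N" by (simp add: abs_prts)
  have absD0: "0 \<le> \<bar>D\<bar>" by simp
  have nonneg: "ob_apply (\<bar>D\<bar>) x = 0" if x: "0 \<le> x" and Dx: "ob_apply D x = 0" for x
  proof -
    have "inf (ob_apply ?P x) (ob_apply ?N x) = 0"
      using D x by (intro Orth_disjoint_apply_same inf_pprt_nprt Orth_pprt Orth_uminus Orth_nprt) auto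
    moreover have "ob_apply ?P x = ob_apply ?N x"
      using Dx arg_cong[OF pprt_minus_nprt[of D], of "\<lambda>T. ob_apply T x"]
      by (simp add: eq_neg_iff_add_eq_0)
    ultimately have "ob_apply ?P x = 0" "ob_apply ?N x = 0" by simp_all
    then show ?thesis by (simp only: absD plus_ob_op.rep_eq add_0)
  qed
  have eq: "ob_apply D x = 0 \<longleftrightarrow> ob_apply (\<bar>D\<bar>) (\<bar>x\<bar>) = 0" for x
  proof
    assume "ob_apply (\<bar>D\<bar>) (\<bar>x\<bar>) = 0"
    then show "ob_apply D x = 0" using ob_apply_abs_le[of D x] by simp
  next
    assume Dx: "ob_apply D x = 0"
    have "pprt x \<perp> - nprt x" using disjoint_pprt_nprt[of x] by simp
    then have "ob_apply D (pprt x) \<perp> ob_apply D (- nprt x)"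
      using OrthD[OF D] disjoint_sym by blast
    moreover have "ob_apply D (pprt x) = ob_apply D (- nprt x)"
      using Dx arg_cong[OF pprt_minus_nprt[of x], of "ob_apply D"]
      by (simp add: eq_neg_iff_add_eq_0)
    ultimately have "ob_apply D (pprt x) = 0" "ob_apply D (- nprt x) = 0"
      using disjoint_self by metis+
    then have "ob_apply (\<bar>D\<bar>) (pprt x) = 0" "ob_apply (\<bar>D\<bar>) (- nprt x) = 0"
      by (intro nonneg; simp)+
    then show "ob_apply (\<bar>D\<bar>) (\<bar>x\<bar>) = 0" by (simp add: abs_prts)
  qed
  show ?thesis
    unfolding band_def ideal_def order_closed_def
  proof (intro conjI ballI impI allI subset_UNIV)
    show "subspace {x. ob_apply D x = 0}" by (simp add: subspace_def)
    show "x \<in> {x. ob_apply D x = 0}"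
      if "y \<in> {x. ob_apply D x = 0}" "\<bar>x\<bar> \<le> \<bar>y\<bar>" for x y
    proof -
      have "ob_apply (\<bar>D\<bar>) (\<bar>x\<bar>) \<le> 0"
        using that(1) ob_apply_mono_arg[OF absD0 that(2)] by (simp add: eq)
      then have "ob_apply (\<bar>D\<bar>) (\<bar>x\<bar>) = 0"
        using ob_apply_nonneg[OF absD0 abs_ge_zero] by (rule order_antisym)
      then show ?thesis by (simp add: eq)
    qed
    fix A :: "'a set" and r x l
    assume *: "order_converges UNIV A r x l \<and> x ` A \<subseteq> {x. ob_apply D x = 0}"
    obtain Y where Y: "down_to_zero Y" "\<And>c. c \<in> Y \<Longrightarrow> \<exists>a\<in>A. \<bar>l - x a\<bar> \<le> c"
      using order_converges_approx[OF conjunct1[OF *]] by metis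
    have "\<bar>ob_apply D l\<bar> \<le> ob_apply (\<bar>D\<bar>) c" if c: "c \<in> Y" for c
    proof -
      obtain a where a: "a \<in> A" "\<bar>l - x a\<bar> \<le> c" using Y(2)[OF c] by blast
      have "\<bar>ob_apply D l\<bar> = \<bar>ob_apply D (l - x a)\<bar>" using * a(1) by auto
      also have "\<dots> \<le> ob_apply (\<bar>D\<bar>) (\<bar>l - x a\<bar>)" by (rule ob_apply_abs_le)
      also have "\<dots> \<le> ob_apply (\<bar>D\<bar>) c" by (intro ob_apply_mono_arg a absD0)
      finally show ?thesis .
    qed
    then have "\<bar>ob_apply D l\<bar> \<le> 0"
      using down_to_zeroD[OF Y(1)] Orth_order_continuous[OF Orth_abs[OF D] absD0, of Y "\<bar>ob_apply D l\<bar>"] by simp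
    then show "l \<in> {x. ob_apply D x = 0}" by simp
  qed
qed

section \<open>Multiplication by an orthomorphism\<close>

text \<open>
  An orthomorphism \<open>T \<ge> 1\<close> reflects positivity. For surjectivity, a solution of \<open>T y = z\<close> is the
  largest \<open>y \<ge> 0\<close> with \<open>T y \<le> z\<close>. If the defect \<open>r = z - T y\<close> were not \<open>0\<close>, then for some \<open>n\<close> the
  component \<open>r2\<close> of \<open>r\<close> on which \<open>T r \<le> n r\<close> would be non-zero, and \<open>y\<close> could be enlarged by \<open>r2 / n\<close>.
\<close>
lemma Orth_inverse:
  fixes T :: "'a::dedekind_complete_vector_lattice ob_op"
  assumes T: "T \<in> Orth" and T1: "1 \<le> T"
  obtains V where "0 \<le> V" "V * T = 1" "T * V = 1"
proof -
  let ?T = "ob_apply T"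
  have T0: "0 \<le> T" by (rule order_trans[OF zero_le_one_ob_op T1])
  have ge: "x \<le> ?T x" if "0 \<le> x" for x
    using ob_apply_mono[OF T1 that] by simp
  have reflect: "0 \<le> x" if "0 \<le> ?T x" for x
  proof -
    have "?T (pprt x) \<perp> ?T (- nprt x)"
      using OrthD[OF T] disjoint_pprt_nprt[of x] by (meson disjoint_sym disjoint_uminus_iff(2))
    then have "?T (- nprt x) \<perp> ?T (- nprt x)"
    proof (rule disjoint_mono)
      have "?T (- nprt x) \<le> ?T (pprt x)"
        using that arg_cong[OF pprt_minus_nprt[of x], of ?T]
        by (subst diff_ge_0_iff_ge[symmetric]) simp
      moreover have "0 \<le> ?T (- nprt x)"
        by (intro ob_apply_nonneg T0) simp
      ultimately show "\<bar>?T (- nprt x)\<bar> \<le> \<bar>?T (pprt x)\<bar>" by (simp del: ob_apply_simps)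
    qed simp
    then have "?T (- nprt x) = 0" by (rule disjoint_self)
    moreover have "- nprt x \<le> ?T (- nprt x)" by (intro ge) simp
    ultimately have "nprt x = 0" by (simp only: order_antisym neg_le_0_iff_le nprt_le_zero)
    then show ?thesis using zero_le_iff_zero_nprt by blast
  qed
  have inj: "x = y" if "?T x = ?T y" for x y
    using reflect[of "x - y"] reflect[of "y - x"] that by simp
  have surj_pos: "\<exists>y. ?T y = z" if z: "0 \<le> z" for z
  proof -
    define W where "W = {w. 0 \<le> w \<and> ?T w \<le> z}"
    have W0: "0 \<in> W" using z by (simp add: W_def)
    have bdd: "bdd_above W"
      using ge unfolding W_def by (intro bdd_aboveI[of _ z]) (blast intro: order_trans)
    define y where "y = Sup W"
    have y0: "0 \<le> y" unfolding y_def by (intro cSup_upper W0 bdd)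
    have wy: "w \<le> y" if "w \<in> W" for w unfolding y_def by (intro cSup_upper that bdd)
    have Tyz: "?T y - z \<le> 0"
    proof (rule Orth_order_continuous[OF T T0, of "(\<lambda>w. y - w) ` W"])
      show "u \<le> 0" if u: "\<And>x. x \<in> (\<lambda>w. y - w) ` W \<Longrightarrow> u \<le> x" for u
      proof -
        have "w \<le> y - u" if "w \<in> W" for w using u[of "y - w"] that by (simp add: algebra_simps)
        then have "y \<le> y - u" unfolding y_def using W0 by (intro cSup_least) auto
        then show ?thesis by (simp add: algebra_simps)
      qed
      show "?T y - z \<le> ?T x" if "x \<in> (\<lambda>w. y - w) ` W" for x
        using that by (auto simp: W_def algebra_simps)
    qed (use W0 wy in auto)
    define r where "r = z - ?T y"
    have r0: "0 \<le> r" using Tyz by (simp add: r_def)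
    have small: "w = 0" if w: "0 \<le> w" "?T w \<le> r" for w
    proof -
      have "y + w \<in> W" using w y0 by (simp add: W_def r_def algebra_simps)
      then have "w \<le> 0" using wy[of "y + w"] by simp
      then show ?thesis using w(1) by (rule order_antisym)
    qed
    have "real n *\<^sub>R r \<le> ?T r" if n: "0 < n" for n
    proof -
      define p where "p = pprt (real n *\<^sub>R r - ?T r)"
      obtain r1 r2 where d: "r = r1 + r2" "0 \<le> r1" "0 \<le> r2" "r1 \<perp> p" "\<And>c. c \<perp> p \<Longrightarrow> r2 \<perp> c"
        using disjoint_band_decomposition[OF r0] by metis
      have p_eq: "p = pprt ((real n *\<^sub>R r1 - ?T r1) + (real n *\<^sub>R r2 - ?T r2))"
        unfolding p_def d(1) by (simp add: algebra_simps)
      have "0 \<le> real n *\<^sub>R r2 - ?T r2"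
        by (rule split_signs(2)[of "real n *\<^sub>R r1 - ?T r1"]; unfold p_eq[symmetric];
            intro disjoint_diff disjoint_scaleR OrthD[OF T] d(4,5))
      then have "inverse (real n) *\<^sub>R ?T r2 \<le> inverse (real n) *\<^sub>R real n *\<^sub>R r2"
        by (intro scaleR_left_mono) auto
      then have "?T (inverse (real n) *\<^sub>R r2) \<le> r"
        using n d(1,2) by (simp add: add_increasing)
      then have "inverse (real n) *\<^sub>R r2 = 0"
        using d(3) by (intro small scaleR_nonneg_nonneg) auto
      then have "r2 = 0" using n by simp
      then have "r \<perp> p" using d by simp
      then have "real n *\<^sub>R r - ?T r \<perp> p"
        by (intro disjoint_diff disjoint_scaleR OrthD[OF T])
      then have "p \<perp> p"
        unfolding p_def using disjoint_prts_iff by blast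
      then have "p = 0" by (rule disjoint_self)
      then show ?thesis using le_pprt[of "real n *\<^sub>R r - ?T r"] by (simp add: p_def)
    qed
    then have "r \<le> 0" by (rule Archimedean_le_zero)
    then show ?thesis using r0 unfolding r_def by (intro exI[of _ y]) simp
  qed
  have "\<exists>y. ?T y = z" for z
  proof -
    obtain y1 y2 where "?T y1 = pprt z" "?T y2 = - nprt z"
      using surj_pos[of "pprt z"] surj_pos[of "- nprt z"] by auto
    then have "?T (y1 - y2) = z" using prts[of z] by simp
    then show ?thesis by blast
  qed
  then obtain V where V: "\<And>z. ?T (V z) = z" by metis
  have VT: "V (?T x) = x" for x by (rule inj) (rule V)
  have lin: "linear V"
    by (rule linearI; rule inj) (simp_all add: V)
  have pos: "0 \<le> V x" if "0 \<le> x" for x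
    by (rule reflect) (simp add: V that)
  have app: "ob_apply (Ob_op V) = V"
    using lin positive_linear_order_bounded[OF lin pos] by (simp add: Ob_op_inverse)
  show thesis
  proof (rule that)
    show "0 \<le> Ob_op V" by (rule ob_leI) (simp add: app pos)
    show "Ob_op V * T = 1" by (rule ob_eqI) (simp add: app VT)
    show "T * Ob_op V = 1" by (rule ob_eqI) (simp add: app V)
  qed
qed

text \<open>
  Multiplication by \<open>T\<close> on either side has the positive inverse of multiplication by \<open>V\<close> and therefore
  preserves infima.
\<close>
lemma inf_mult_Orth:
  fixes T A B :: "'a::dedekind_complete_vector_lattice ob_op"
  assumes T: "T \<in> Orth" "1 \<le> T" and AB: "inf A B = 0"
  shows "inf (T * A) (T * B) = 0" "inf (A * T) (B * T) = 0"
proof -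
  obtain V where V: "0 \<le> V" "V * T = 1" "T * V = 1"
    using Orth_inverse[OF T] .
  have T0: "0 \<le> T" by (rule order_trans[OF zero_le_one_ob_op T(2)])
  have A0: "0 \<le> A" "0 \<le> B" using AB by (metis inf_le1 inf_le2)+
  have "V * inf (T * A) (T * B) \<le> V * (T * A)" "V * inf (T * A) (T * B) \<le> V * (T * B)"
    using V(1) by (intro mult_left_mono; simp)+
  then have "V * inf (T * A) (T * B) \<le> inf A B"
    by (simp add: V flip: mult.assoc)
  then have "T * (V * inf (T * A) (T * B)) \<le> T * 0"
    using T0 AB by (intro mult_left_mono) simp_all
  then have "inf (T * A) (T * B) \<le> 0"
    by (simp only: V mult_1_left mult_zero_right flip: mult.assoc)
  then show "inf (T * A) (T * B) = 0"
    using T0 A0 by (intro order_antisym) simp_all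
  have "inf (A * T) (B * T) * V \<le> A * T * V" "inf (A * T) (B * T) * V \<le> B * T * V"
    using V(1) by (intro mult_right_mono; simp)+
  then have "inf (A * T) (B * T) * V \<le> inf A B"
    by (simp add: V mult.assoc)
  then have "inf (A * T) (B * T) * V * T \<le> 0 * T"
    using T0 AB by (intro mult_right_mono) simp_all
  then have "inf (A * T) (B * T) \<le> 0"
    by (simp only: V mult_1_right mult_zero_left mult.assoc)
  then show "inf (A * T) (B * T) = 0"
    using T0 A0 by (intro order_antisym) simp_all
qed

definition left_mult :: "'a::dedekind_complete_vector_lattice ob_op \<Rightarrow> 'a ob_op ob_op" where
  "left_mult T = Ob_op (\<lambda>S. T * S)"

definition right_mult :: "'a::dedekind_complete_vector_lattice ob_op \<Rightarrow> 'a ob_op ob_op" where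
  "right_mult T = Ob_op (\<lambda>S. S * T)"

lemma left_mult_apply [simp]: "ob_apply (left_mult T) S = T * S"
proof -
  have lin: "linear (\<lambda>S. U * S)" for U :: "'a ob_op"
    by (rule linearI) (simp_all add: distrib_left)
  \<comment> \<open>Splitting \<open>T\<close> writes the multiplication as a difference of two positive operators.\<close>
  have "order_bounded (\<lambda>S. pprt T * S + - ((- nprt T) * S))"
    by (intro order_bounded_add order_bounded_uminus positive_linear_order_bounded lin mult_nonneg_nonneg)
      simp_all
  also have "(\<lambda>S. pprt T * S + - ((- nprt T) * S)) = (\<lambda>S. T * S)"
    by (simp flip: distrib_right prts)
  finally show ?thesis
    unfolding left_mult_def using lin by (simp add: Ob_op_inverse)
qed

lemma right_mult_apply [simp]: "ob_apply (right_mult T) S = S * T"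
proof -
  have lin: "linear (\<lambda>S. S * U)" for U :: "'a ob_op"
    by (rule linearI) (simp_all add: distrib_right)
  have "order_bounded (\<lambda>S. S * pprt T + - (S * (- nprt T)))"
    by (intro order_bounded_add order_bounded_uminus positive_linear_order_bounded lin mult_nonneg_nonneg)
      simp_all
  also have "(\<lambda>S. S * pprt T + - (S * (- nprt T))) = (\<lambda>S. S * T)"
    by (simp flip: distrib_left prts)
  finally show ?thesis
    unfolding right_mult_def using lin by (simp add: Ob_op_inverse)
qed

text \<open>
  With \<open>W = \<bar>T\<bar> + 1\<close>, both \<open>T * S\<close> and \<open>R\<close> are dominated in absolute value by \<open>W * \<bar>S\<bar>\<close> and
  \<open>W * \<bar>R\<bar>\<close>, and these are disjoint when \<open>S\<close> and \<open>R\<close> are; likewise on the right.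
\<close>
lemma multiplication_in_Orth:
  fixes T :: "'a::dedekind_complete_vector_lattice ob_op"
  assumes T: "T \<in> Orth"
  shows "left_mult T \<in> Orth" "right_mult T \<in> Orth"
proof -
  let ?W = "\<bar>T\<bar> + 1"
  have W: "?W \<in> Orth" "1 \<le> ?W" "\<bar>T\<bar> \<le> ?W"
    using T by (auto simp: zero_le_one_ob_op intro: subspace_add[OF subspace_Orth] Orth_abs one_in_Orth)
  have W0: "0 \<le> ?W" by (rule order_trans[OF zero_le_one_ob_op W(2)])
  have "T * S \<perp> R \<and> S * T \<perp> R" if "S \<perp> R" for S R
  proof
    have SR: "inf (\<bar>S\<bar>) (\<bar>R\<bar>) = 0" using that by (simp add: disjoint_def)
    have "?W * \<bar>S\<bar> \<perp> ?W * \<bar>R\<bar>"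
      using inf_mult_Orth(1)[OF W(1,2) SR] W0 by (simp add: disjoint_nonneg_iff)
    moreover have "\<bar>T * S\<bar> \<le> \<bar>?W * \<bar>S\<bar>\<bar>"
      using abs_le_mult[of T S] mult_right_mono[OF W(3), of "\<bar>S\<bar>"] W0
      by (simp add: order_trans[of "\<bar>T * S\<bar>" "\<bar>T\<bar> * \<bar>S\<bar>"])
    moreover have "\<bar>R\<bar> \<le> \<bar>?W * \<bar>R\<bar>\<bar>"
      using mult_right_mono[OF W(2), of "\<bar>R\<bar>"] W0 by simp
    ultimately show "T * S \<perp> R" by (rule disjoint_mono)
    have "\<bar>S\<bar> * ?W \<perp> \<bar>R\<bar> * ?W"
      using inf_mult_Orth(2)[OF W(1,2) SR] W0 by (simp add: disjoint_nonneg_iff)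
    moreover have "\<bar>S * T\<bar> \<le> \<bar>\<bar>S\<bar> * ?W\<bar>"
      using abs_le_mult[of S T] mult_left_mono[OF W(3), of "\<bar>S\<bar>"] W0
      by (simp add: order_trans[of "\<bar>S * T\<bar>" "\<bar>S\<bar> * \<bar>T\<bar>"])
    moreover have "\<bar>R\<bar> \<le> \<bar>\<bar>R\<bar> * ?W\<bar>"
      using mult_left_mono[OF W(2), of "\<bar>R\<bar>"] W0 by simp
    ultimately show "S * T \<perp> R" by (rule disjoint_mono)
  qed
  then show "left_mult T \<in> Orth" "right_mult T \<in> Orth"
    by (simp_all add: Orth_iff)
qed

text \<open>
  The operators commuting with \<open>T\<close> are the kernel of an orthomorphism on the space of operators.
\<close>
lemma band_commuting:
  assumes "T \<in> Orth"
  shows "band UNIV {S. T * S = S * T}"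
proof -
  have "left_mult T - right_mult T \<in> Orth"
    by (intro subspace_diff[OF subspace_Orth] multiplication_in_Orth assms)
  from band_Orth_kernel[OF this] show ?thesis by simp
qed

section \<open>The commutant\<close>

lemma orth_commutantD:
  assumes "T \<in> orth_commutant X"
  shows "T \<in> Orth" "S \<in> X \<Longrightarrow> T * S = S * T"
  using assms by (auto simp: orth_commutant_def)

lemma orth_commutant_generated_band:
  "orth_commutant X = orth_commutant (generated_band UNIV X)"
proof
  show "orth_commutant X \<subseteq> orth_commutant (generated_band UNIV X)"
  proof
    fix T assume T: "T \<in> orth_commutant X"
    have "generated_band UNIV X \<subseteq> {S. T * S = S * T}"
      unfolding generated_band_def
      using band_commuting[OF orth_commutantD(1)[OF T]] orth_commutantD(2)[OF T] by blast
    then show "T \<in> orth_commutant (generated_band UNIV X)"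
      using T by (auto simp: orth_commutant_def)
  qed
  show "orth_commutant (generated_band UNIV X) \<subseteq> orth_commutant X"
    unfolding orth_commutant_def generated_band_def by blast
qed

lemma subspace_orth_commutant: "subspace (orth_commutant X)"
  using subspace_0[OF subspace_Orth] subspace_add[OF subspace_Orth] subspace_scale[OF subspace_Orth]
  by (auto simp: subspace_def orth_commutant_def algebra_simps)

lemma one_in_orth_commutant: "1 \<in> orth_commutant X"
  by (simp add: orth_commutant_def one_in_Orth)

lemma orth_commutant_mult:
  assumes "T \<in> orth_commutant X" "U \<in> orth_commutant X"
  shows "T * U \<in> orth_commutant X"
  using assms by (auto simp: orth_commutant_def Orth_mult) (metis mult.assoc)

text \<open>
  Write \<open>T = P - N\<close> with \<open>P\<close> and \<open>N\<close> the positive and negative parts. Then \<open>P S\<close> and \<open>N S\<close> are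
  disjoint because the values of \<open>P\<close> and \<open>N\<close> are, and \<open>S P\<close> and \<open>S N\<close> are disjoint because every
  \<open>x \<ge> 0\<close> splits into a part killed by \<open>P\<close> and a part killed by \<open>N\<close>. As \<open>T S = S T\<close> is the difference
  of both pairs, the pairs agree.
\<close>
lemma commute_pprt_nonneg:
  fixes T S :: "'a::dedekind_complete_vector_lattice ob_op"
  assumes T: "T \<in> Orth" and S: "0 \<le> S" and comm: "T * S = S * T"
  shows "pprt T * S = S * pprt T"
proof -
  let ?P = "pprt T" and ?N = "- nprt T"
  have PN: "?P \<in> Orth" "0 \<le> ?P" "?N \<in> Orth" "0 \<le> ?N" "inf ?P ?N = 0"
    using T by (simp_all add: Orth_pprt Orth_nprt Orth_uminus inf_pprt_nprt del: neg_inf_eq_sup)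
  note disj = Orth_disjoint_apply[OF PN]
  have nonneg: "0 \<le> inf (?P * S) (?N * S)" "0 \<le> inf (S * ?P) (S * ?N)"
    using PN S by (intro inf_greatest mult_nonneg_nonneg; simp)+
  have "inf (?P * S) (?N * S) \<le> 0"
  proof (rule ob_leI)
    fix x :: 'a assume x: "0 \<le> x"
    have Sx: "0 \<le> ob_apply S x" by (rule ob_apply_nonneg[OF S x])
    have "ob_apply (inf (?P * S) (?N * S)) x \<le> inf (ob_apply ?P (ob_apply S x)) (ob_apply ?N (ob_apply S x))"
      using ob_apply_mono[OF inf_le1 x, of "?P * S" "?N * S"] ob_apply_mono[OF inf_le2 x, of "?P * S" "?N * S"]
      by (intro inf_greatest) (simp_all only: times_ob_op.rep_eq o_apply)
    also have "\<dots> = 0" by (rule disj[OF Sx Sx])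
    finally show "ob_apply (inf (?P * S) (?N * S)) x \<le> ob_apply 0 x" by simp
  qed
  then have 1: "inf (?P * S) (?N * S) = 0" using nonneg(1) by (rule order_antisym)
  have "inf (S * ?P) (S * ?N) \<le> 0"
  proof (rule ob_leI)
    fix x :: 'a assume x: "0 \<le> x"
    let ?w = "ob_apply ?P x"
    have w0: "0 \<le> ?w" by (rule ob_apply_nonneg[OF PN(2) x])
    obtain x1 x2 where d: "x = x1 + x2" "0 \<le> x1" "0 \<le> x2" "x1 \<perp> ?w" "\<And>c. c \<perp> ?w \<Longrightarrow> x2 \<perp> c"
      using disjoint_band_decomposition[OF x] by metis
    have Px1: "ob_apply ?P x1 = 0"
    proof (rule disjoint_self, rule disjoint_mono)
      show "ob_apply ?P x1 \<perp> ?w" by (rule OrthD[OF PN(1) d(4)])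
      have "ob_apply ?P x1 \<le> ?w" using d(1,3) by (intro ob_apply_mono_arg PN) simp
      then show "\<bar>ob_apply ?P x1\<bar> \<le> \<bar>?w\<bar>" using ob_apply_nonneg[OF PN(2) d(2)] w0 by simp
    qed simp
    have Nx2: "ob_apply ?N x2 = 0"
    proof (rule disjoint_self, rule disjoint_mono)
      have "ob_apply ?N x \<perp> ?w"
        using disj[OF x x] ob_apply_nonneg[OF PN(4) x] w0
        by (subst disjoint_nonneg_iff) (simp_all only: inf_commute)
      then have "x2 \<perp> ob_apply ?N x" by (rule d(5))
      then show "ob_apply ?N x2 \<perp> ob_apply ?N x" by (rule OrthD[OF PN(3)])
      have "ob_apply ?N x2 \<le> ob_apply ?N x" using d(1,2) by (intro ob_apply_mono_arg PN) simp
      then show "\<bar>ob_apply ?N x2\<bar> \<le> \<bar>ob_apply ?N x\<bar>"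
        using ob_apply_nonneg[OF PN(4) d(3)] ob_apply_nonneg[OF PN(4) x] by (simp only: abs_of_nonneg)
    qed simp
    have "ob_apply (inf (S * ?P) (S * ?N)) x1 \<le> ob_apply (S * ?P) x1"
      "ob_apply (inf (S * ?P) (S * ?N)) x2 \<le> ob_apply (S * ?N) x2"
      by (rule ob_apply_mono[OF inf_le1 d(2)]) (rule ob_apply_mono[OF inf_le2 d(3)])
    moreover have "ob_apply (S * ?P) x1 = 0" "ob_apply (S * ?N) x2 = 0"
      using Px1 Nx2 by (simp_all only: times_ob_op.rep_eq o_apply linear_0[OF linear_ob_apply])
    ultimately show "ob_apply (inf (S * ?P) (S * ?N)) x \<le> ob_apply 0 x"
      unfolding d(1) linear_add[OF linear_ob_apply] by (simp only: add_nonpos_nonpos zero_ob_op.rep_eq add_0)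
  qed
  then have 2: "inf (S * ?P) (S * ?N) = 0" using nonneg(2) by (rule order_antisym)
  have "?P * S - ?N * S = S * ?P - S * ?N"
    using comm by (simp only: pprt_minus_nprt flip: left_diff_distrib right_diff_distrib)
  then show ?thesis by (rule disjoint_decomposition_unique[OF 1 2])
qed

lemma commute_pprt:
  fixes T S :: "'a::dedekind_complete_vector_lattice ob_op"
  assumes T: "T \<in> Orth" and comm: "T * S = S * T"
  shows "pprt T * S = S * pprt T"
proof -
  have "R \<in> {S. T * S = S * T}" if "\<bar>R\<bar> \<le> \<bar>S\<bar>" for R
    using band_commuting[OF T] comm that unfolding band_def ideal_def by blast
  then have "T * pprt S = pprt S * T" "T * (- nprt S) = (- nprt S) * T"
    using pprt_le_abs[of S] minus_nprt_le_abs[of S] by simp_all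
  then have "pprt T * pprt S = pprt S * pprt T" "pprt T * (- nprt S) = (- nprt S) * pprt T"
    by (intro commute_pprt_nonneg T; simp)+
  then have "pprt T * (pprt S - (- nprt S)) = (pprt S - (- nprt S)) * pprt T"
    by (simp only: left_diff_distrib right_diff_distrib)
  then show ?thesis by (simp only: pprt_minus_nprt)
qed

lemma vector_sublattice_orth_commutant: "vector_sublattice (orth_commutant X)"
proof -
  note sub = subspace_orth_commutant[of X]
  have sup: "sup T U \<in> orth_commutant X" if TU: "T \<in> orth_commutant X" "U \<in> orth_commutant X" for T U
  proof -
    have D: "T - U \<in> orth_commutant X" using TU by (rule subspace_diff[OF sub])
    have "pprt (T - U) \<in> orth_commutant X"
      using D Orth_pprt commute_pprt by (auto simp: orth_commutant_def)
    then have "pprt (T - U) + U \<in> orth_commutant X" using TU(2) by (rule subspace_add[OF sub])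
    also have "pprt (T - U) + U = sup T U" by (simp add: pprt_def add_sup_distrib_right)
    finally show ?thesis .
  qed
  have "inf T U \<in> orth_commutant X" if "T \<in> orth_commutant X" "U \<in> orth_commutant X" for T U
    unfolding inf_eq_neg_sup using that by (intro subspace_neg[OF sub] sup)
  then show ?thesis
    unfolding vector_sublattice_def using sub sup by blast
qed

lemma orth_commutant_abs: "T \<in> orth_commutant X \<Longrightarrow> \<bar>T\<bar> \<in> orth_commutant X"
  using vector_sublattice_orth_commutant[of X] subspace_neg[OF subspace_orth_commutant]
  unfolding abs_lattice vector_sublattice_def by blast

section \<open>The identity as a weak order unit\<close>

text \<open>
  The mixed products of the positive and negative parts vanish, because \<open>A (B x)\<close> is disjoint from
  \<open>B x\<close> and hence from itself when \<open>A\<close> and \<open>B\<close> are disjoint.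
\<close>
lemma Orth_square_nonneg:
  assumes T: "T \<in> Orth"
  shows "0 \<le> T * T"
proof -
  let ?P = "pprt T" and ?N = "- nprt T"
  have *: "A * B = 0" if AB: "A \<in> Orth" "0 \<le> A" "B \<in> Orth" "0 \<le> B" "inf A B = 0"
    for A B :: "'a ob_op"
  proof (rule ob_eqI)
    fix x :: 'a assume x: "0 \<le> x"
    have Bx: "0 \<le> ob_apply B x" by (rule ob_apply_nonneg[OF AB(4) x])
    have "ob_apply B x \<perp> ob_apply A (ob_apply B x)"
      using Orth_disjoint_apply[OF AB Bx x] Bx ob_apply_nonneg[OF AB(2) Bx]
      by (simp add: disjoint_nonneg_iff inf_commute)
    then have "ob_apply A (ob_apply B x) \<perp> ob_apply A (ob_apply B x)" by (rule OrthD[OF AB(1)])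
    then show "ob_apply (A * B) x = ob_apply 0 x" by (simp add: disjoint_self)
  qed
  have PN: "?P \<in> Orth" "0 \<le> ?P" "?N \<in> Orth" "0 \<le> ?N" "inf ?P ?N = 0"
    using T by (simp_all add: Orth_pprt Orth_nprt Orth_uminus inf_pprt_nprt del: neg_inf_eq_sup)
  have "?P * ?N = 0" "?N * ?P = 0"
    using *[OF PN] *[OF PN(3,4,1,2)] PN(5) by (simp_all only: inf_commute)
  then have "(?P - ?N) * (?P - ?N) = ?P * ?P + ?N * ?N"
    by (simp only: left_diff_distrib right_diff_distrib) simp
  then have "T * T = ?P * ?P + ?N * ?N" by (simp only: pprt_minus_nprt)
  also have "0 \<le> \<dots>" using PN by (intro add_nonneg_nonneg mult_nonneg_nonneg)
  finally show ?thesis .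
qed

text \<open>
  For real numbers, \<open>n (t - n) \<le> t^2\<close> follows from \<open>(t - n / 2)^2 \<ge> 0\<close>; the same computation with
  orthomorphisms bounds \<open>T - inf T n\<close> by \<open>T^2 / n\<close>, so that the truncations of \<open>T\<close> converge to \<open>T\<close>.
\<close>
lemma Orth_truncation_bound:
  assumes T: "T \<in> Orth" and n: "0 < n"
  shows "n *\<^sub>R pprt (T - n *\<^sub>R 1) \<le> T * T"
proof -
  let ?h = "(n / 2) *\<^sub>R (1::'a ob_op)"
  have "0 \<le> (T - ?h) * (T - ?h)"
    using T by (intro Orth_square_nonneg subspace_diff[OF subspace_Orth] subspace_scale[OF subspace_Orth] one_in_Orth)
  also have "\<dots> = T * T - n *\<^sub>R T + (n * n / 4) *\<^sub>R 1"
  proof -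
    have "(n / 2) *\<^sub>R T + (n / 2) *\<^sub>R T = n *\<^sub>R T" by (simp flip: scaleR_left_distrib)
    then show ?thesis by (simp add: algebra_simps)
  qed
  finally have "n *\<^sub>R T \<le> T * T + (n * n / 4) *\<^sub>R 1" by (simp add: algebra_simps)
  also have "\<dots> \<le> T * T + (n * n) *\<^sub>R 1"
    by (intro add_left_mono scaleR_right_mono zero_le_one_ob_op) simp
  finally have "n *\<^sub>R (T - n *\<^sub>R 1) \<le> T * T" by (simp add: algebra_simps)
  then have "inverse n *\<^sub>R n *\<^sub>R (T - n *\<^sub>R 1) \<le> inverse n *\<^sub>R (T * T)"
    using n by (intro scaleR_left_mono) auto
  then have "pprt (T - n *\<^sub>R 1) \<le> inverse n *\<^sub>R (T * T)"
    using n Orth_square_nonneg[OF T] by (intro pprt_least scaleR_nonneg_nonneg) auto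
  then have "n *\<^sub>R pprt (T - n *\<^sub>R 1) \<le> n *\<^sub>R inverse n *\<^sub>R (T * T)"
    using n by (intro scaleR_left_mono) auto
  then show ?thesis using n by simp
qed

lemma weak_order_unit_orth_commutant: "weak_order_unit (orth_commutant X) 1"
proof -
  let ?C = "orth_commutant X"
  have "band ?C ?C"
    unfolding band_def ideal_def order_closed_def
    by (auto simp: subspace_orth_commutant order_converges_def)
  moreover have "T \<in> B" if T: "T \<in> ?C" and B: "band ?C B" and B1: "1 \<in> B" for T B
  proof -
    have sub: "subspace B" and closed: "order_closed ?C B"
      and solid: "\<And>x y. x \<in> ?C \<Longrightarrow> y \<in> B \<Longrightarrow> \<bar>x\<bar> \<le> \<bar>y\<bar> \<Longrightarrow> x \<in> B"
      using B unfolding band_def ideal_def by blast+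
    let ?T = "\<bar>T\<bar>"
    let ?x = "\<lambda>n::nat. inf ?T (real n *\<^sub>R 1)" and ?y = "\<lambda>n::nat. pprt (?T - real n *\<^sub>R 1)"
    have TC: "?T \<in> ?C" using T by (rule orth_commutant_abs)
    have nC: "real n *\<^sub>R 1 \<in> ?C" for n
      by (intro subspace_scale[OF subspace_orth_commutant] one_in_orth_commutant)
    have n0: "0 \<le> real n *\<^sub>R (1::'a ob_op)" for n
      by (intro scaleR_nonneg_nonneg zero_le_one_ob_op) simp
    have xC: "?x n \<in> ?C" for n
      using vector_sublattice_orth_commutant[of X] TC nC unfolding vector_sublattice_def by blast
    have Tx: "?T - ?x n = ?y n" for n
      by (simp add: pprt_def add_sup_distrib_left sup_commute)
    have yC: "?y n \<in> ?C" for n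
      unfolding Tx[symmetric] by (intro subspace_diff[OF subspace_orth_commutant] TC xC)
    have dir: "directed (UNIV::nat set) (\<le>)"
      unfolding directed_def by (auto simp: reflp_on_def transp_on_def intro: le_cases)
    have "order_converges ?C UNIV (\<le>) ?x ?T"
    proof (rule order_convergesI[OF dir])
      have mono: "?y m \<le> ?y n" if "n \<le> m" for n m
        using that by (intro pprt_mono diff_left_mono scaleR_right_mono zero_le_one_ob_op) simp
      have glb: "u \<le> 0" if u: "\<And>n. u \<le> ?y n" for u
      proof (rule Archimedean_le_zero)
        fix n :: nat assume n: "0 < n"
        have "real n *\<^sub>R u \<le> real n *\<^sub>R ?y n"
          using u by (intro scaleR_left_mono) auto
        also have "\<dots> \<le> ?T * ?T"
          using n by (intro Orth_truncation_bound orth_commutantD(1)[OF TC]) simp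
        finally show "real n *\<^sub>R u \<le> ?T * ?T" .
      qed
      show "decreases_to_zero ?C UNIV (\<le>) ?y"
        unfolding decreases_to_zero_def isGlb_iff
      proof (intro conjI ballI impI dir subspace_0[OF subspace_orth_commutant] mono)
        show "range ?y \<subseteq> ?C" using yC by blast
        show "0 \<le> v" if "v \<in> range ?y" for v using that by (elim rangeE) simp
        show "u \<le> 0" if "\<forall>v\<in>range ?y. u \<le> v" for u
          using that by (intro glb) blast
      qed
      fix b :: nat
      have "\<bar>?T - ?x m\<bar> \<le> ?y b" if "b \<le> m" for m
        unfolding Tx using mono[OF that] by (simp only: abs_of_nonneg zero_le_pprt)
      then show "\<exists>a\<in>UNIV. \<forall>a'\<in>UNIV. a \<le> a' \<longrightarrow> \<bar>?T - ?x a'\<bar> \<le> ?y b" by blast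
    qed (use xC TC in auto)
    moreover have "?x n \<in> B" for n
      using n0[of n] subspace_scale[OF sub B1, of "real n"]
      by (intro solid[OF xC, of "real n *\<^sub>R 1"]) (simp_all add: abs_of_nonneg)
    ultimately have "?T \<in> B"
      by (intro order_closedD[OF closed]) auto
    then show "T \<in> B" by (rule solid[OF T]) simp
  qed
  ultimately have "generated_band ?C {1} = ?C"
    unfolding generated_band_def using one_in_orth_commutant[of X] by auto
  then show ?thesis
    unfolding weak_order_unit_def using one_in_orth_commutant by blast
qed

section \<open>Order closedness\<close>

text \<open>
  If \<open>U a\<close> commutes with \<open>S\<close> for all \<open>a\<close> and converges to \<open>T\<close>, then
  \<open>(T S - S T) x = (T - U a) (S x) - S ((T - U a) x)\<close>. Both terms tend to \<open>0\<close>, the second one because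
  \<open>S\<close> is order continuous.
\<close>
lemma order_closed_orth_commutant:
  fixes X :: "'a::dedekind_complete_vector_lattice ob_op set"
  assumes X: "X \<subseteq> L_oc"
  shows "order_closed UNIV (orth_commutant X)"
  unfolding order_closed_def
proof (intro conjI allI impI subset_UNIV)
  fix A :: "'a ob_op set" and r U T
  assume *: "order_converges UNIV A r U T \<and> U ` A \<subseteq> orth_commutant X"
  obtain Y where Y0: "down_to_zero Y" and approx: "\<And>c. c \<in> Y \<Longrightarrow> \<exists>a\<in>A. \<bar>T - U a\<bar> \<le> c"
    using order_converges_approx[OF conjunct1[OF *]] by metis
  note Y = down_to_zeroD[OF Y0]
  have U: "U a \<in> Orth" "S \<in> X \<Longrightarrow> U a * S = S * U a" if "a \<in> A" for a S
    using * that by (auto simp: orth_commutant_def)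
  note inf0 = directed_Inf_zero_apply[OF Y0]
  have close: "\<bar>ob_apply (T - U a) x\<bar> \<le> ob_apply c (\<bar>x\<bar>)" if "\<bar>T - U a\<bar> \<le> c" for a c x
    using ob_apply_abs_le[of "T - U a" x] ob_apply_mono[OF that abs_ge_zero] by (rule order_trans)
  have "T \<in> Orth"
  proof (rule OrthI_nonneg)
    fix x y :: 'a assume xy: "0 \<le> x" "0 \<le> y" "x \<perp> y"
    have "inf (\<bar>ob_apply T x\<bar>) (\<bar>y\<bar>) \<le> ob_apply c x" if c: "c \<in> Y" for c
    proof -
      obtain a where a: "a \<in> A" "\<bar>T - U a\<bar> \<le> c" using approx[OF c] by blast
      have "\<bar>ob_apply T x\<bar> \<le> \<bar>ob_apply (T - U a) x\<bar> + \<bar>ob_apply (U a) x\<bar>"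
        using abs_triangle_ineq[of "ob_apply (T - U a) x" "ob_apply (U a) x"] by simp
      also have "\<dots> \<le> ob_apply c x + \<bar>ob_apply (U a) x\<bar>"
        using close[OF a(2), of x] xy(1) by (intro add_right_mono) simp
      finally have "inf (\<bar>ob_apply T x\<bar>) (\<bar>y\<bar>) \<le> inf (ob_apply c x + \<bar>ob_apply (U a) x\<bar>) (\<bar>y\<bar>)"
        by (intro inf_mono) simp_all
      also have "\<dots> \<le> inf (ob_apply c x) (\<bar>y\<bar>) + inf (\<bar>ob_apply (U a) x\<bar>) (\<bar>y\<bar>)"
        using ob_apply_nonneg[OF Y(2)[OF c] xy(1)] by (intro inf_add_le) auto
      also have "inf (\<bar>ob_apply (U a) x\<bar>) (\<bar>y\<bar>) = 0"
        using OrthD[OF U(1)[OF a(1)] xy(3)] by (simp add: disjoint_def)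
      finally show ?thesis by simp
    qed
    then have "inf (\<bar>ob_apply T x\<bar>) (\<bar>y\<bar>) \<le> 0" by (rule inf0[OF xy(1)])
    moreover have "0 \<le> inf (\<bar>ob_apply T x\<bar>) (\<bar>y\<bar>)" by simp
    ultimately show "ob_apply T x \<perp> y"
      unfolding disjoint_def by (rule order_antisym)
  qed
  moreover have "T * S = S * T" if S: "S \<in> X" for S
  proof (rule ob_eqI)
    fix x :: 'a assume x: "0 \<le> x"
    let ?S = "ob_apply S"
    \<comment> \<open>Order continuity of \<open>S\<close> concerns nets in \<open>'a\<close>, so the operators in \<open>Y\<close> are replaced by their
      values at a single point. The point \<open>x'\<close> dominates both \<open>x\<close> and \<open>S x\<close>, so that one value
      controls \<open>T - U a\<close> at both.\<close>
    define x' where "x' = x + \<bar>?S x\<bar>"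
    have x'0: "0 \<le> x'" and x'x: "\<bar>x\<bar> \<le> x'" "\<bar>?S x\<bar> \<le> x'" using x by (simp_all add: x'_def)
    define W where "W = (\<lambda>c. ob_apply c x') ` Y"
    have "\<exists>a\<in>A. \<forall>z. \<bar>z\<bar> \<le> x' \<longrightarrow> \<bar>ob_apply (T - U a) z\<bar> \<le> w" if w: "w \<in> W" for w
    proof -
      obtain c where c: "c \<in> Y" "w = ob_apply c x'" using w by (auto simp: W_def)
      obtain a where a: "a \<in> A" "\<bar>T - U a\<bar> \<le> c" using approx[OF c(1)] by blast
      have "\<bar>ob_apply (T - U a) z\<bar> \<le> w" if "\<bar>z\<bar> \<le> x'" for z
        using close[OF a(2)] ob_apply_mono_arg[OF Y(2)[OF c(1)] that] unfolding c(2)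
        by (rule order_trans)
      then show ?thesis using a(1) by blast
    qed
    then obtain a where a: "\<And>w. w \<in> W \<Longrightarrow> a w \<in> A"
      "\<And>w z. w \<in> W \<Longrightarrow> \<bar>z\<bar> \<le> x' \<Longrightarrow> \<bar>ob_apply (T - U (a w)) z\<bar> \<le> w"
      by metis
    define v where "v w = ob_apply (T - U (a w)) x" for w
    have W0: "W \<noteq> {}" "\<And>w. w \<in> W \<Longrightarrow> 0 \<le> w"
      using Y(1) ob_apply_nonneg[OF Y(2) x'0] by (auto simp: W_def)
    have Winf: "u \<le> 0" if "\<And>w. w \<in> W \<Longrightarrow> u \<le> w" for u
      using that by (intro inf0[OF x'0]) (auto simp: W_def)
    have Wdir: "\<exists>w\<in>W. w \<le> u \<and> w \<le> u'" if u: "u \<in> W" "u' \<in> W" for u u'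
    proof -
      obtain c d where cd: "c \<in> Y" "d \<in> Y" "u = ob_apply c x'" "u' = ob_apply d x'"
        using u by (auto simp: W_def)
      obtain e where "e \<in> Y" "e \<le> c" "e \<le> d" using Y(3)[OF cd(1,2)] by blast
      then show ?thesis
        unfolding cd(3,4) W_def using ob_apply_mono[OF _ x'0] by blast
    qed
    have dir: "directed W (\<lambda>u w. w \<le> u)"
      unfolding directed_def using W0 Wdir by (auto simp: reflp_on_def transp_on_def)
    have dec: "decreases_to_zero UNIV W (\<lambda>u w. w \<le> u) (\<lambda>w. w)"
      unfolding decreases_to_zero_def isGlb_iff using dir W0 Winf by auto
    have "order_converges UNIV W (\<lambda>u w. w \<le> u) v 0"
    proof (rule order_convergesI[OF dir _ _ dec])
      fix w assume w: "w \<in> W"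
      have "\<bar>0 - v w'\<bar> \<le> w" if "w' \<in> W" "w' \<le> w" for w'
      proof -
        have "\<bar>v w'\<bar> \<le> w'" unfolding v_def by (rule a(2)[OF that(1) x'x(1)])
        then show ?thesis using that(2) by simp
      qed
      then show "\<exists>w0\<in>W. \<forall>w'\<in>W. w' \<le> w0 \<longrightarrow> \<bar>0 - v w'\<bar> \<le> w" using w by blast
    qed simp_all
    then have "order_converges UNIV W (\<lambda>u w. w \<le> u) (?S \<circ> v) 0"
      using X S unfolding L_oc_def order_continuous_def by blast
    then obtain Z where Z: "down_to_zero Z"
      "\<And>z. z \<in> Z \<Longrightarrow> \<exists>w0\<in>W. \<forall>w\<in>W. w \<le> w0 \<longrightarrow> \<bar>0 - (?S \<circ> v) w\<bar> \<le> z"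
      using order_convergesE by metis
    let ?d = "\<bar>ob_apply (T * S) x - ob_apply (S * T) x\<bar>"
    have d: "?d \<le> w + \<bar>?S (v w)\<bar>" if w: "w \<in> W" for w
    proof -
      have "ob_apply (U (a w)) (?S x) = ?S (ob_apply (U (a w)) x)"
        using arg_cong[OF U(2)[OF a(1)[OF w] S], of "\<lambda>V. ob_apply V x"] by simp
      then have "?d = \<bar>ob_apply (T - U (a w)) (?S x) - ?S (v w)\<bar>"
        by (simp add: v_def)
      also have "\<dots> \<le> \<bar>ob_apply (T - U (a w)) (?S x)\<bar> + \<bar>?S (v w)\<bar>"
        by (rule abs_triangle_ineq4)
      also have "\<dots> \<le> w + \<bar>?S (v w)\<bar>"
        by (intro add_right_mono a(2) w x'x)
      finally show ?thesis .
    qed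
    have "?d \<le> z" if z: "z \<in> Z" for z
    proof -
      obtain w0 where w0: "w0 \<in> W" "\<And>w. w \<in> W \<Longrightarrow> w \<le> w0 \<Longrightarrow> \<bar>?S (v w)\<bar> \<le> z"
        using Z(2)[OF z] by auto
      have "?d - z \<le> w" if w: "w \<in> W" for w
      proof -
        obtain w' where w': "w' \<in> W" "w' \<le> w" "w' \<le> w0" using Wdir[OF w w0(1)] by blast
        have "?d \<le> w' + \<bar>?S (v w')\<bar>" by (rule d[OF w'(1)])
        also have "\<dots> \<le> w + z" by (intro add_mono w' w0)
        finally show ?thesis by (simp only: diff_le_eq)
      qed
      then have "?d - z \<le> 0" by (rule Winf)
      then show ?thesis by (simp only: diff_le_0_iff_le)
    qed
    then have "?d \<le> 0" by (rule down_to_zeroD(4)[OF Z(1)])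
    then show "ob_apply (T * S) x = ob_apply (S * T) x" by simp
  qed
  ultimately show "T \<in> orth_commutant X" by (simp add: orth_commutant_def)
qed

text \<open>
  Regularity turns order convergence in \<open>F\<close> into order convergence in the whole space.
\<close>
lemma order_closed_regular_sublattice:
  fixes F H :: "'g::vector_lattice set"
  assumes H: "order_closed UNIV H" "H \<subseteq> F" and F: "regular_sublattice UNIV F"
  shows "order_closed F H"
  unfolding order_closed_def
proof (intro conjI allI impI H(2))
  fix A :: "'g set" and r x l
  assume *: "order_converges F A r x l \<and> x ` A \<subseteq> H"
  have F': "subspace F" using F unfolding regular_sublattice_def vector_sublattice_def by blast
  have abs: "\<bar>0 - (x a - l)\<bar> = \<bar>l - x a\<bar>" for a by simp
  have "order_converges F A r (\<lambda>a. x a - l) 0"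
    using * subspace_0[OF F'] subspace_diff[OF F']
    unfolding order_converges_def abs by auto
  then have "order_converges UNIV A r (\<lambda>a. x a - l) 0" by (rule regularD[OF F])
  then have "order_converges UNIV A r x l" unfolding order_converges_def abs by simp
  then show "l \<in> H" using * by (intro order_closedD[OF H(1)]) auto
qed

text \<open>
  The infimum in the whole space of a net decreasing to \<open>0\<close> in \<open>H\<close> belongs to \<open>H\<close> by order
  closedness, and so it is \<open>0\<close> as well.
\<close>
lemma decreases_to_zero_order_closed:
  fixes F H :: "'g::dedekind_complete_vector_lattice set"
  assumes H: "order_closed UNIV H" "subspace H" "H \<subseteq> F"
    and y: "decreases_to_zero H B s y"
  shows "decreases_to_zero F B s y"
proof -
  let ?D = "(\<lambda>b. - y b) ` B"
  have dir: "directed B s" and yH: "\<And>b. b \<in> B \<Longrightarrow> y b \<in> H"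
    and anti: "\<And>b c. b \<in> B \<Longrightarrow> c \<in> B \<Longrightarrow> s b c \<Longrightarrow> y c \<le> y b"
    and y0: "\<And>b. b \<in> B \<Longrightarrow> 0 \<le> y b"
    and glb: "\<And>u. u \<in> H \<Longrightarrow> (\<And>b. b \<in> B \<Longrightarrow> u \<le> y b) \<Longrightarrow> u \<le> 0"
    using y unfolding decreases_to_zero_def isGlb_iff by auto
  have "upward_directed ?D"
    unfolding upward_directed_def
  proof (intro conjI ballI)
    fix u v assume "u \<in> ?D" "v \<in> ?D"
    then obtain b c where bc: "b \<in> B" "c \<in> B" "u = - y b" "v = - y c" by blast
    then obtain e where "e \<in> B" "s b e" "s c e" using dir unfolding directed_def by blast
    then show "\<exists>w\<in>?D. u \<le> w \<and> v \<le> w" using anti bc by auto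
  qed (use dir in \<open>auto simp: directed_def\<close>)
  moreover have bdd: "bdd_above ?D" using y0 by (intro bdd_aboveI[of _ 0]) auto
  moreover have "?D \<subseteq> H" using yH subspace_neg[OF H(2)] by auto
  ultimately have "Sup ?D \<in> H" by (intro order_closed_Sup[OF H(1)])
  then have "- Sup ?D \<in> H" by (rule subspace_neg[OF H(2)])
  moreover have "- Sup ?D \<le> y b" if "b \<in> B" for b
    using cSup_upper[OF imageI[OF that] bdd] by (simp only: minus_le_iff)
  ultimately have "- Sup ?D \<le> 0" by (rule glb)
  then have "u \<le> 0" if "\<And>b. b \<in> B \<Longrightarrow> u \<le> y b" for u
  proof -
    have "Sup ?D \<le> - u"
      using dir that by (intro cSup_least) (auto simp: directed_def)
    then have "u \<le> - Sup ?D" by (rule le_minus_iff[THEN iffD1])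
    also note \<open>- Sup ?D \<le> 0\<close>
    finally show ?thesis .
  qed
  then show ?thesis
    unfolding decreases_to_zero_def isGlb_iff
    using dir yH anti y0 H(3) subspace_0[OF H(2)] by auto
qed

lemma regular_sublattice_order_closed:
  fixes F H :: "'g::dedekind_complete_vector_lattice set"
  assumes H: "order_closed UNIV H" "vector_sublattice H" "H \<subseteq> F"
  shows "regular_sublattice F H"
proof -
  have sub: "subspace H" using H(2) unfolding vector_sublattice_def by blast
  have "order_converges F A r x 0" if "order_converges H A r x 0" for A :: "'g set" and r x
    using that decreases_to_zero_order_closed[OF H(1) sub H(3)] H(3)
    unfolding order_converges_def by (meson subset_trans subsetD)
  then show ?thesis
    unfolding regular_sublattice_def order_continuous_def comp_def using H by blast
qed

text \<open>
  The supremum in the whole space is an order limit of suprema of finite subsets, which belong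
  to \<open>H\<close>.
\<close>
lemma dedekind_complete_order_closed:
  fixes H :: "'g::dedekind_complete_vector_lattice set"
  assumes H: "order_closed UNIV H" "vector_sublattice H"
  shows "dedekind_complete H"
  unfolding dedekind_complete_def
proof (intro allI impI, elim conjE exE)
  fix X u assume X: "X \<subseteq> H" "X \<noteq> {}" "isUb H X u"
  let ?D = "sup_closure X"
  have DH: "?D \<subseteq> H"
  proof
    fix d assume "d \<in> ?D"
    then show "d \<in> H" using X(1) H(2) by induction (auto simp: vector_sublattice_def)
  qed
  have Du: "d \<le> v" if "d \<in> ?D" "\<And>x. x \<in> X \<Longrightarrow> x \<le> v" for d v
    using that by (rule sup_closure_le)
  have Xu: "x \<le> u" if "x \<in> X" for x
    using X(3) that by (auto simp: isUb_def setle_def)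
  have bdd: "bdd_above ?D" using Du Xu by (intro bdd_aboveI[of _ u]) blast
  have dir: "upward_directed ?D" by (rule upward_directed_sup_closure[OF X(2)])
  have "Sup ?D \<in> H" by (rule order_closed_Sup[OF H(1) DH dir bdd])
  moreover have "x \<le> Sup ?D" if "x \<in> X" for x
    by (rule cSup_upper[OF sup_closure.base[OF that] bdd])
  moreover have "Sup ?D \<le> v" if "\<And>x. x \<in> X \<Longrightarrow> x \<le> v" for v
    using dir Du that by (intro cSup_least) (auto simp: upward_directed_def)
  ultimately have "isLub H X (Sup ?D)" unfolding isLub_iff by blast
  then show "\<exists>s. isLub H X s" by blast
qed

section \<open>The common commutant\<close>
theorem theorem6p2:
  fixes \<S> :: "'a::dedekind_complete_vector_lattice ob_op set"
  assumes "\<S> \<noteq> {}"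
  shows "orth_commutant \<S> = orth_commutant (generated_band UNIV \<S>) \<and>
    vector_lattice_subalgebra Orth (orth_commutant \<S>) \<and>
    weak_order_unit (orth_commutant \<S>) 1 \<and>
    (\<S> \<subseteq> L_oc \<longrightarrow>
      (\<forall>F. regular_sublattice UNIV F \<and> orth_commutant \<S> \<subseteq> F \<longrightarrow>
         vector_sublattice (orth_commutant \<S>) \<and> order_closed F (orth_commutant \<S>)) \<and>
      (\<forall>F. regular_sublattice UNIV F \<and> dedekind_complete F \<and> orth_commutant \<S> \<subseteq> F \<longrightarrow>
         regular_sublattice F (orth_commutant \<S>)) \<and>
      dedekind_complete (orth_commutant \<S>))"
proof -
  let ?C = "orth_commutant \<S>"
  have lattice: "vector_sublattice ?C"
    by (rule vector_sublattice_orth_commutant)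
  have "vector_lattice_subalgebra Orth ?C"
    unfolding vector_lattice_subalgebra_def
    using lattice orth_commutant_mult orth_commutantD(1) by blast
  moreover have "order_closed UNIV ?C" if "\<S> \<subseteq> L_oc"
    using that by (rule order_closed_orth_commutant)
  ultimately show ?thesis
    using orth_commutant_generated_band weak_order_unit_orth_commutant lattice
      order_closed_regular_sublattice regular_sublattice_order_closed dedekind_complete_order_closed
    by blast
qed

end
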